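(* Let $u\in\mathbb{R}^d$, $\theta>0$ and $h>0$. For every $F_0\in\mathcal{E}_{u,\theta}$ there exists a unique $F_1\in\mathcal{E}_{u,\theta}$ such that $$I(F_1)\le I(F)\qquad\text{for all }F\in\mathcal{E}_{u,\theta},$$ where $$I(F)=\frac{W_2^2(F_0,F)}{\theta}+hS(F).$$
   Context: $\mathcal{P}$ denotes the set of probability densities $F$ on $\mathbb{R}^d$ (with respect to Lebesgue measure) with $\int_{\mathbb{R}^d}|v|^2F(v)\,dv<\infty$. For $u\in\mathbb{R}^d$, $\theta>0$, $$\mathcal{E}_{u,\theta}=\Big\{F\in\mathcal{P}:\ \tfrac1d\int_{\mathbb{R}^d}|v-u|^2F(v)\,dv=\theta,\ \int_{\mathbb{R}^d}vF(v)\,dv=u\Big\}.$$ The $2$-Wasserstein distance is normalized with a factor $\tfrac12$: $W_2^2(F_0,F_1)=\inf_\gamma\int_{\mathbb{R}^d\times\mathbb{R}^d}\tfrac12|v-w|^2\,\gamma(dv,dw)$, the infimum being over all couplings $\gamma$ of $F_0(v)dv$ and $F_1(w)dw$. The entropy is $S(F)=\int_{\mathbb{R}^d}F(v)\ln F(v)\,dv\in(-\infty,+\infty]$. *)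

theory Defs
  imports "HOL-Analysis.Analysis"
begin

text \<open>
  The space \<open>\<real>\<^sup>d\<close> is rendered by a type of class \<open>euclidean_space\<close>, with \<open>d = DIM('a)\<close>.
  A density is represented by an actual nonnegative Borel function; two functions that agree
  almost everywhere are the same density, so uniqueness of densities is meant almost everywhere.
\<close>

definition prob_densities :: "('a::euclidean_space \<Rightarrow> real) set" where
  "prob_densities = {F. F \<in> borel_measurable borel \<and> (\<forall>v. 0 \<le> F v) \<and>
     (\<integral>\<^sup>+v. ennreal (F v) \<partial>lborel) = 1 \<and>
     (\<integral>\<^sup>+v. ennreal ((norm v)\<^sup>2 * F v) \<partial>lborel) < \<infinity>}"

definition fixed_moment_densities :: "'a::euclidean_space \<Rightarrow> real \<Rightarrow> ('a \<Rightarrow> real) set" where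
  "fixed_moment_densities u \<theta> = {F \<in> prob_densities.
     1 / real DIM('a) * (\<integral>v. (norm (v - u))\<^sup>2 * F v \<partial>lborel) = \<theta> \<and>
     (\<integral>v. F v *\<^sub>R v \<partial>lborel) = u}"

definition couplings :: "('a::euclidean_space \<Rightarrow> real) \<Rightarrow> ('a \<Rightarrow> real) \<Rightarrow> ('a \<times> 'a) measure set" where
  "couplings F\<^sub>0 F\<^sub>1 = {\<gamma>. sets \<gamma> = sets (borel \<Otimes>\<^sub>M borel) \<and>
     distr \<gamma> borel fst = density lborel (\<lambda>v. ennreal (F\<^sub>0 v)) \<and>
     distr \<gamma> borel snd = density lborel (\<lambda>w. ennreal (F\<^sub>1 w))}"

text \<open>The squared distance, normalized with the factor \<open>1/2\<close> in the cost.\<close>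

definition wasserstein2_sq :: "('a::euclidean_space \<Rightarrow> real) \<Rightarrow> ('a \<Rightarrow> real) \<Rightarrow> ennreal" where
  "wasserstein2_sq F\<^sub>0 F\<^sub>1 =
     (INF \<gamma>\<in>couplings F\<^sub>0 F\<^sub>1. \<integral>\<^sup>+(v, w). ennreal (1 / 2 * (norm (v - w))\<^sup>2) \<partial>\<gamma>)"

text \<open>
  The extended integral of \<open>F ln F\<close> as the integral of its positive part minus that of its
  negative part (\<open>ennreal\<close> truncates negative arguments to 0). For a density with finite second
  moment the negative part has a finite integral, so the value lies in \<open>(-\<infinity>, \<infinity>]\<close>.
  Where \<open>F v = 0\<close> the integrand is 0.
\<close>

definition entropy_functional :: "('a::euclidean_space \<Rightarrow> real) \<Rightarrow> ereal" where
  "entropy_functional F =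
     enn2ereal (\<integral>\<^sup>+v. ennreal (F v * ln (F v)) \<partial>lborel) -
     enn2ereal (\<integral>\<^sup>+v. ennreal (- (F v * ln (F v))) \<partial>lborel)"

definition step_functional ::
    "real \<Rightarrow> real \<Rightarrow> ('a::euclidean_space \<Rightarrow> real) \<Rightarrow> ('a \<Rightarrow> real) \<Rightarrow> ereal" where
  "step_functional \<theta> h F\<^sub>0 F =
     enn2ereal (wasserstein2_sq F\<^sub>0 F) / ereal \<theta> + ereal h * entropy_functional F"

end

theory Submission
  imports Defs "HOL-Probability.Distributions"
begin

text \<open>
  For densities \<open>F\<close> with the same mean and variance as \<open>F\<^sub>0\<close>, the transport cost of a coupling equals
  \<open>d \<theta>\<close> minus its correlation, and the entropy equals, up to a constant, the relative entropy \<open>H\<close> with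
  respect to the Gaussian \<open>exp (- |v - u|\<^sup>2 / (2 \<theta>))\<close>. The functional is convex, and the convexity of
  \<open>x ln x\<close> is quantitative: the midpoint gap of two densities bounds their squared Hellinger
  distance. Hence minimizers are unique, and every minimizing sequence is Cauchy in \<open>L\<^sup>1\<close>, so that
  no weak compactness is needed.

  In the \<open>L\<^sup>1\<close> limit \<open>F\<close> some second moment may escape to infinity. Couplings of \<open>F\<^sub>0\<close> with the
  sequence are modified into couplings of \<open>F\<^sub>0\<close> with \<open>F\<close> whose correlation is almost as large, and
  \<open>H\<close> is lower semicontinuous. Dilating \<open>F\<close> by a factor \<open>c \<ge> 1\<close> restores the variance; this does
  not decrease nonnegative correlations, and it does not increase \<open>H\<close> because
  \<open>ln x \<ge> 1 - 1 / x\<close> for \<open>x = c\<^sup>2\<close>. The dilated density is therefore a minimizer.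
\<close>

subsection \<open>Sums of measures and couplings\<close>

text \<open>The constraint set is not closed under L1 limits: mass \<open>e\<close> at a distance of
  order \<open>1 / sqrt e\<close> can disappear in the limit and take a fixed amount of variance
  with it. Transport costs are not continuous under such a loss, but correlations with a fixed
  \<open>F\<^sub>0\<close> are: on a part of small mass the variable distributed by
  \<open>F\<^sub>0\<close> has small second moment, so by Cauchy-Schwarz that part carries little
  correlation. Fatou's lemma leaves the limit with second moment at most \<open>d * \<theta>\<close>
  about \<open>u\<close>, hence at most that about its own mean, which is why the dilation factor is
  never below 1. The mean of the limit is not tracked: the dilation is about that mean and recentres
  at \<open>u\<close>, and since \<open>F\<^sub>0\<close> has mean \<open>u\<close>, a translation
  of the second variable leaves the correlation alone. If the correlation is negative, the
  independent coupling, of correlation 0, does better. The factor 1/2 in the cost makes the constant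
  exactly \<open>d * \<theta>\<close>, half of it from each marginal.\<close>

definition add_measures :: "'a measure \<Rightarrow> 'a measure \<Rightarrow> 'a measure" where
  "add_measures M N = measure_of (space M) (sets M) (\<lambda>A. emeasure M A + emeasure N A)"

lemma sets_add_measures [simp, measurable_cong]: "sets (add_measures M N) = sets M"
  and space_add_measures [simp]: "space (add_measures M N) = space M"
  by (auto simp: add_measures_def)

lemma emeasure_add_measures:
  assumes "sets N = sets M" "A \<in> sets M"
  shows "emeasure (add_measures M N) A = emeasure M A + emeasure N A"
  unfolding add_measures_def
proof (rule emeasure_measure_of_sigma)
  show "countably_additive (sets M) (\<lambda>A. emeasure M A + emeasure N A)"
  proof (rule countably_additiveI)
    fix B :: "nat \<Rightarrow> _"
    assume "range B \<subseteq> sets M" "disjoint_family B"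
    then show "(\<Sum>i. emeasure M (B i) + emeasure N (B i)) = emeasure M (\<Union>i. B i) + emeasure N (\<Union>i. B i)"
      using assms by (simp add: suminf_add[symmetric] suminf_emeasure)
  qed
qed (use assms in \<open>auto simp: positive_def sets.sigma_algebra_axioms\<close>)

text \<open>Needed for the average of two couplings and for a coupling glued from a retained part
  and an independent remainder. In the monotone limit both integrals increase with the index, so the
  supremum of their sums splits.\<close>

lemma nn_integral_add_measures:
  assumes "sets N = sets M" and f: "f \<in> borel_measurable M"
  shows "(\<integral>\<^sup>+x. f x \<partial>add_measures M N) = (\<integral>\<^sup>+x. f x \<partial>M) + (\<integral>\<^sup>+x. f x \<partial>N)"
  using f
proof induction
  case (cong f g)
  then show ?case
    using assms(1) sets_eq_imp_space_eq[OF assms(1)]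
    by (simp cong: nn_integral_cong_simp)
next
  case (set A)
  then show ?case using assms(1) by (simp add: emeasure_add_measures)
next
  case (mult u c)
  moreover have "u \<in> borel_measurable N" "u \<in> borel_measurable (add_measures M N)"
    using mult(2) assms(1) by (simp_all cong: measurable_cong_sets)
  ultimately show ?case by (simp add: nn_integral_cmult distrib_left)
next
  case (add u v)
  moreover have "u \<in> borel_measurable N" "u \<in> borel_measurable (add_measures M N)"
    "v \<in> borel_measurable N" "v \<in> borel_measurable (add_measures M N)"
    using add assms(1) by (simp_all cong: measurable_cong_sets)
  ultimately show ?case by (simp add: nn_integral_add ac_simps)
next
  case (seq U)
  have *: "U i \<in> borel_measurable N" "U i \<in> borel_measurable (add_measures M N)" for i
    using seq(1)[of i] assms(1) by (simp_all cong: measurable_cong_sets)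
  have inc: "incseq (\<lambda>i. integral\<^sup>N L (U i))" for L
    using seq(3) by (auto simp: incseq_def le_fun_def intro!: nn_integral_mono)
  have **: "integral\<^sup>N L (\<lambda>x. (SUP i. U i) x) = (SUP i. integral\<^sup>N L (U i))"
    if "\<And>i. U i \<in> borel_measurable L" for L
    using nn_integral_monotone_convergence_SUP[OF seq(3) that] unfolding SUP_apply .
  have "integral\<^sup>N (add_measures M N) (\<lambda>x. (SUP i. U i) x) = (SUP i. integral\<^sup>N M (U i) + integral\<^sup>N N (U i))"
    by (subst **[OF *(2)]) (simp add: seq)
  also have "\<dots> = (SUP i. integral\<^sup>N M (U i)) + (SUP i. integral\<^sup>N N (U i))"
    by (intro ennreal_SUP_add inc)
  finally show ?case by (simp only: **[OF *(1)] **[OF seq(1)])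
qed

section \<open>Couplings and their modification\<close>

lemma coupling_measurable [simp]:
  assumes "\<gamma> \<in> couplings F\<^sub>0 F\<^sub>1"
  shows "measurable \<gamma> N = measurable (borel \<Otimes>\<^sub>M borel) N"
  using assms by (intro measurable_cong_sets) (auto simp: couplings_def)

lemma nn_integral_coupling_fst:
  assumes "\<gamma> \<in> couplings F\<^sub>0 F\<^sub>1" and [measurable]: "F\<^sub>0 \<in> borel_measurable borel" "f \<in> borel_measurable borel"
  shows "(\<integral>\<^sup>+z. f (fst z) \<partial>\<gamma>) = (\<integral>\<^sup>+v. ennreal (F\<^sub>0 v) * f v \<partial>lborel)"
proof -
  have "(\<integral>\<^sup>+z. f (fst z) \<partial>\<gamma>) = (\<integral>\<^sup>+v. f v \<partial>distr \<gamma> borel fst)"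
    by (subst nn_integral_distr) (simp_all add: coupling_measurable[OF assms(1)])
  also have "distr \<gamma> borel fst = density lborel (\<lambda>v. ennreal (F\<^sub>0 v))"
    using assms by (simp add: couplings_def)
  finally show ?thesis by (simp add: nn_integral_density)
qed

lemma nn_integral_coupling_snd:
  assumes "\<gamma> \<in> couplings F\<^sub>0 F\<^sub>1" and [measurable]: "F\<^sub>1 \<in> borel_measurable borel" "f \<in> borel_measurable borel"
  shows "(\<integral>\<^sup>+z. f (snd z) \<partial>\<gamma>) = (\<integral>\<^sup>+v. ennreal (F\<^sub>1 v) * f v \<partial>lborel)"
proof -
  have "(\<integral>\<^sup>+z. f (snd z) \<partial>\<gamma>) = (\<integral>\<^sup>+v. f v \<partial>distr \<gamma> borel snd)"
    by (subst nn_integral_distr) (simp_all add: coupling_measurable[OF assms(1)])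
  also have "distr \<gamma> borel snd = density lborel (\<lambda>v. ennreal (F\<^sub>1 v))"
    using assms by (simp add: couplings_def)
  finally show ?thesis by (simp add: nn_integral_density)
qed

text \<open>Marginals are tested by integrating indicators rather than as pushforward measures,
  because integrals are what sums, densities, products and scalings of measures compute
  directly.\<close>

lemma couplingI:
  fixes \<gamma> :: "('a::euclidean_space \<times> 'a) measure"
  assumes sets: "sets \<gamma> = sets (borel \<Otimes>\<^sub>M borel)"
    and [measurable]: "F\<^sub>0 \<in> borel_measurable borel" "F\<^sub>1 \<in> borel_measurable borel"
    and fst: "\<And>A. A \<in> sets borel \<Longrightarrow> (\<integral>\<^sup>+z. indicator A (fst z) \<partial>\<gamma>) = (\<integral>\<^sup>+v. ennreal (F\<^sub>0 v) * indicator A v \<partial>lborel)"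
    and snd: "\<And>A. A \<in> sets borel \<Longrightarrow> (\<integral>\<^sup>+z. indicator A (snd z) \<partial>\<gamma>) = (\<integral>\<^sup>+v. ennreal (F\<^sub>1 v) * indicator A v \<partial>lborel)"
  shows "\<gamma> \<in> couplings F\<^sub>0 F\<^sub>1"
proof -
  have m: "measurable \<gamma> N = measurable (borel \<Otimes>\<^sub>M borel) N" for N :: "'a measure"
    by (intro measurable_cong_sets) (auto simp: sets)
  have m': "measurable \<gamma> N = measurable (borel \<Otimes>\<^sub>M borel) N" for N :: "ennreal measure"
    by (intro measurable_cong_sets) (auto simp: sets)
  have "distr \<gamma> borel fst = density lborel (\<lambda>v. ennreal (F\<^sub>0 v))"
  proof (rule measure_eqI)
    fix A :: "'a set" assume "A \<in> sets (distr \<gamma> borel fst)"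
    then have [measurable]: "A \<in> sets borel" by simp
    have "emeasure (distr \<gamma> borel fst) A = (\<integral>\<^sup>+v. indicator A v \<partial>distr \<gamma> borel fst)" by simp
    also have "\<dots> = (\<integral>\<^sup>+z. indicator A (fst z) \<partial>\<gamma>)"
      by (subst nn_integral_distr) (simp_all add: m)
    finally show "emeasure (distr \<gamma> borel fst) A = emeasure (density lborel (\<lambda>v. ennreal (F\<^sub>0 v))) A"
      by (simp add: fst emeasure_density)
  qed simp
  moreover have "distr \<gamma> borel snd = density lborel (\<lambda>v. ennreal (F\<^sub>1 v))"
  proof (rule measure_eqI)
    fix A :: "'a set" assume "A \<in> sets (distr \<gamma> borel snd)"
    then have [measurable]: "A \<in> sets borel" by simp
    have "emeasure (distr \<gamma> borel snd) A = (\<integral>\<^sup>+v. indicator A v \<partial>distr \<gamma> borel snd)" by simp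
    also have "\<dots> = (\<integral>\<^sup>+z. indicator A (snd z) \<partial>\<gamma>)"
      by (subst nn_integral_distr) (simp_all add: m)
    finally show "emeasure (distr \<gamma> borel snd) A = emeasure (density lborel (\<lambda>v. ennreal (F\<^sub>1 v))) A"
      by (simp add: snd emeasure_density)
  qed simp
  ultimately show ?thesis using sets by (simp add: couplings_def)
qed

lemma prob_densities_measurable [measurable_dest]: "F \<in> prob_densities \<Longrightarrow> F \<in> borel_measurable borel"
  and prob_densities_nonneg: "F \<in> prob_densities \<Longrightarrow> 0 \<le> F v"
  and prob_densities_nn_integral: "F \<in> prob_densities \<Longrightarrow> (\<integral>\<^sup>+v. ennreal (F v) \<partial>lborel) = 1"
  by (auto simp: prob_densities_def)

lemma prob_space_prob_densities:
  assumes "F \<in> prob_densities"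
  shows "prob_space (density lborel (\<lambda>v. ennreal (F v)))"
  using assms by (intro prob_spaceI) (auto simp: prob_densities_def emeasure_density)

text \<open>The independent coupling shows that the infimum in \<open>wasserstein2_sq\<close> runs
  over a nonempty set, and it serves later as the competitor of correlation zero.\<close>

lemma product_coupling:
  assumes F: "F\<^sub>0 \<in> prob_densities" "F\<^sub>1 \<in> prob_densities"
  shows "density lborel (\<lambda>v. ennreal (F\<^sub>0 v)) \<Otimes>\<^sub>M density lborel (\<lambda>v. ennreal (F\<^sub>1 v)) \<in> couplings F\<^sub>0 F\<^sub>1"
    (is "?M \<Otimes>\<^sub>M ?N \<in> _")
proof -
  note [measurable] = F[THEN prob_densities_measurable]
  interpret M: prob_space ?M by (rule prob_space_prob_densities[OF F(1)])
  interpret N: prob_space ?N by (rule prob_space_prob_densities[OF F(2)])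
  have one: "(\<integral>\<^sup>+v. ennreal (F\<^sub>0 v) \<partial>lborel) = 1" "(\<integral>\<^sup>+v. ennreal (F\<^sub>1 v) \<partial>lborel) = 1"
    using F by (auto simp: prob_densities_nn_integral)
  have [measurable_cong]: "sets ?M = sets borel" "sets ?N = sets borel" by auto
  show ?thesis
  proof (rule couplingI)
    show "sets (?M \<Otimes>\<^sub>M ?N) = sets (borel \<Otimes>\<^sub>M borel)" by (intro sets_pair_measure_cong) auto
    fix A :: "'a set" assume [measurable]: "A \<in> sets borel"
    show "(\<integral>\<^sup>+z. indicator A (fst z) \<partial>(?M \<Otimes>\<^sub>M ?N)) = (\<integral>\<^sup>+v. ennreal (F\<^sub>0 v) * indicator A v \<partial>lborel)"
      by (subst N.nn_integral_fst[symmetric]) (simp_all add: emeasure_density one nn_integral_density)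
    show "(\<integral>\<^sup>+z. indicator A (snd z) \<partial>(?M \<Otimes>\<^sub>M ?N)) = (\<integral>\<^sup>+v. ennreal (F\<^sub>1 v) * indicator A v \<partial>lborel)"
      by (subst N.nn_integral_fst[symmetric]) (simp_all add: emeasure_density one nn_integral_density)
  qed auto
qed

text \<open>Averaging two couplings with a common first marginal keeps that marginal and averages
  the second ones; convexity of the transport cost in its second argument rests on this.\<close>

lemma coupling_midpoint:
  fixes F G H :: "'a::euclidean_space \<Rightarrow> real"
  assumes \<gamma>: "\<gamma> \<in> couplings F G" "\<gamma>' \<in> couplings F H"
    and [measurable]: "F \<in> borel_measurable borel" "G \<in> borel_measurable borel" "H \<in> borel_measurable borel"
    and pos: "\<And>v. 0 \<le> G v" "\<And>v. 0 \<le> H v"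
  shows "scale_measure (1/2) (add_measures \<gamma> \<gamma>') \<in> couplings F (\<lambda>v. (G v + H v) / 2)"
proof -
  have s: "sets \<gamma> = sets (borel \<Otimes>\<^sub>M borel)" "sets \<gamma>' = sets (borel \<Otimes>\<^sub>M borel)"
    using \<gamma> by (auto simp: couplings_def)
  have m: "measurable \<gamma> N = measurable (borel \<Otimes>\<^sub>M borel) N"
      "measurable (add_measures \<gamma> \<gamma>') N = measurable (borel \<Otimes>\<^sub>M borel) N" for N :: "ennreal measure"
    by (auto intro!: measurable_cong_sets simp: s)
  have half: "(1/2) * (x + x) = x" for x :: ennreal
  proof -
    have "(1/2) * (2::ennreal) = 1" by (simp add: ennreal_divide_times)
    then show ?thesis by (metis mult.assoc mult_2 mult_1)
  qed
  show ?thesis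
  proof (rule couplingI)
    fix A :: "'a set" assume [measurable]: "A \<in> sets borel"
    show "(\<integral>\<^sup>+z. indicator A (fst z) \<partial>scale_measure (1/2) (add_measures \<gamma> \<gamma>')) = (\<integral>\<^sup>+v. ennreal (F v) * indicator A v \<partial>lborel)"
      by (simp add: nn_integral_scale_measure nn_integral_add_measures s m half
          nn_integral_coupling_fst[OF \<gamma>(1)] nn_integral_coupling_fst[OF \<gamma>(2)])
    have "(\<integral>\<^sup>+v. ennreal ((G v + H v) / 2) * indicator A v \<partial>lborel)
        = (\<integral>\<^sup>+v. (1/2) * (ennreal (G v) * indicator A v + ennreal (H v) * indicator A v) \<partial>lborel)"
      using pos by (intro nn_integral_cong) (auto simp: ennreal_plus[symmetric] divide_ennreal[symmetric] ennreal_divide_times ennreal_times_divide split: split_indicator simp del: ennreal_plus)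
    also have "\<dots> = (1/2) * ((\<integral>\<^sup>+v. ennreal (G v) * indicator A v \<partial>lborel) + (\<integral>\<^sup>+v. ennreal (H v) * indicator A v \<partial>lborel))"
      by (simp add: nn_integral_cmult nn_integral_add)
    finally show "(\<integral>\<^sup>+z. indicator A (snd z) \<partial>scale_measure (1/2) (add_measures \<gamma> \<gamma>')) = (\<integral>\<^sup>+v. ennreal ((G v + H v) / 2) * indicator A v \<partial>lborel)"
      by (simp add: nn_integral_scale_measure nn_integral_add_measures s m
          nn_integral_coupling_snd[OF \<gamma>(1)] nn_integral_coupling_snd[OF \<gamma>(2)])
  qed (auto simp: s)
qed

text \<open>Integrate the pointwise identity \<open>G + max 0 (F - G) = F + max 0 (G - F)\<close>
  and cancel the common total mass 1. The mass to be removed from \<open>G\<close> thus equals the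
  mass still missing for \<open>F\<close>, so the two remainders can be coupled.\<close>

lemma nn_integral_excess_eq:
  fixes F G :: "'a::euclidean_space \<Rightarrow> real"
  assumes F: "F \<in> prob_densities" and G: "G \<in> prob_densities"
  shows "(\<integral>\<^sup>+w. ennreal (max 0 (F w - G w)) \<partial>lborel) = (\<integral>\<^sup>+w. ennreal (max 0 (G w - F w)) \<partial>lborel)"
proof -
  note [measurable] = F[THEN prob_densities_measurable] G[THEN prob_densities_measurable]
  have "(\<integral>\<^sup>+w. ennreal (G w) + ennreal (max 0 (F w - G w)) \<partial>lborel)
      = (\<integral>\<^sup>+w. ennreal (F w) + ennreal (max 0 (G w - F w)) \<partial>lborel)"
    using prob_densities_nonneg[OF F] prob_densities_nonneg[OF G]
    by (intro nn_integral_cong) (auto simp: ennreal_plus[symmetric] max_def simp del: ennreal_plus)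
  then show ?thesis
    using F G by (simp add: nn_integral_add prob_densities_nn_integral ennreal_add_left_cancel)
qed

text \<open>
  Keep the part of the coupling sitting over \<open>min F G\<close> in the second variable and couple the
  remaining mass independently.
\<close>

lemma coupling_surgery:
  fixes F\<^sub>0 F G :: "'a::euclidean_space \<Rightarrow> real" and c :: "'a \<times> 'a \<Rightarrow> ennreal" and a b :: "'a \<Rightarrow> ennreal"
  assumes F\<^sub>0: "F\<^sub>0 \<in> prob_densities" and F: "F \<in> prob_densities" and G: "G \<in> prob_densities"
    and \<gamma>: "\<gamma> \<in> couplings F\<^sub>0 G"
    and [measurable]: "c \<in> borel_measurable (borel \<Otimes>\<^sub>M borel)" "a \<in> borel_measurable borel" "b \<in> borel_measurable borel"
    and cost: "\<And>v w. c (v, w) \<le> a v + b w"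
  obtains \<gamma>' where "\<gamma>' \<in> couplings F\<^sub>0 F"
    "(\<integral>\<^sup>+z. c z \<partial>\<gamma>') \<le> (\<integral>\<^sup>+z. c z \<partial>\<gamma>) + (R * (\<integral>\<^sup>+w. ennreal (max 0 (F w - G w)) \<partial>lborel)
        + (\<integral>\<^sup>+v. ennreal (F\<^sub>0 v) * (a v * indicator {v. R < a v} v) \<partial>lborel)
        + (\<integral>\<^sup>+w. ennreal (F w) * b w \<partial>lborel))"
proof -
  note [measurable] = F\<^sub>0[THEN prob_densities_measurable] F[THEN prob_densities_measurable] G[THEN prob_densities_measurable]
  define \<epsilon> where "\<epsilon> = (\<integral>\<^sup>+w. ennreal (max 0 (F w - G w)) \<partial>lborel)"
  have \<epsilon>': "\<epsilon> = (\<integral>\<^sup>+w. ennreal (max 0 (G w - F w)) \<partial>lborel)"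
    unfolding \<epsilon>_def by (rule nn_integral_excess_eq[OF F G])
  have Fn: "0 \<le> F v" and Gn: "0 \<le> G v" for v
    using F G by (auto intro: prob_densities_nonneg)
  have \<epsilon>_le: "\<epsilon> \<le> 1"
    unfolding \<epsilon>_def prob_densities_nn_integral[OF F, symmetric]
    using Fn Gn by (intro nn_integral_mono ennreal_leI) (auto simp: max_def)
  show thesis
  \<comment> \<open>The remainder is normalised by \<open>inverse \<epsilon>\<close>, so the case
    without remainder is separate: there \<open>F\<close> and \<open>G\<close> agree almost
    everywhere and \<open>\<gamma>\<close> itself serves.\<close>
  proof (cases "\<epsilon> = 0")
    case True
    have "AE w in lborel. ennreal (max 0 (F w - G w)) = 0" "AE w in lborel. ennreal (max 0 (G w - F w)) = 0"
      using True[unfolded \<epsilon>_def] True[unfolded \<epsilon>'] by (simp_all add: nn_integral_0_iff_AE)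
    then have "AE w in lborel. ennreal (F w) = ennreal (G w)"
      by eventually_elim (auto simp: max_def ennreal_eq_0_iff split: if_splits)
    then have "density lborel (\<lambda>v. ennreal (F v)) = density lborel (\<lambda>v. ennreal (G v))"
      by (intro density_cong) auto
    then have "\<gamma> \<in> couplings F\<^sub>0 F" using \<gamma> by (simp add: couplings_def)
    then show thesis by (rule that) simp
  next
    case False
    have m\<gamma>: "measurable \<gamma> N = measurable (borel \<Otimes>\<^sub>M borel) N" for N :: "'b measure"
      by (rule coupling_measurable[OF \<gamma>])
    have s\<gamma>: "sets \<gamma> = sets (borel \<Otimes>\<^sub>M borel)" using \<gamma> by (simp add: couplings_def)
    \<comment> \<open>The fraction of the mass of \<open>G\<close> at \<open>w\<close> that exceeds
      \<open>F\<close>. Where \<open>G w = 0\<close> the division yields 0, the right value because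
      there is nothing to remove.\<close>
    define r where "r w = max 0 (G w - F w) / G w" for w
    have r: "0 \<le> r w" "r w \<le> 1" "G w * r w = max 0 (G w - F w)" for w
      using Fn[of w] Gn[of w] unfolding r_def by (auto simp: max_def divide_le_eq)
    have [measurable]: "r \<in> borel_measurable borel" unfolding r_def by measurable
    \<comment> \<open>\<open>\<gamma>1\<close> is the retained part, \<open>\<alpha>\<close> the
      first marginal of the removed part and \<open>\<beta>\<close> the missing part of
      \<open>F\<close>; the last two have the same mass \<open>\<epsilon>\<close>.\<close>
    define \<gamma>1 where "\<gamma>1 = density \<gamma> (\<lambda>z. ennreal (1 - r (snd z)))"
    define \<alpha> where "\<alpha> = distr (density \<gamma> (\<lambda>z. ennreal (r (snd z)))) borel fst"
    define \<beta> where "\<beta> = density lborel (\<lambda>w. ennreal (max 0 (F w - G w)))"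
    have sets\<alpha>\<beta>[measurable_cong]: "sets \<alpha> = sets borel" "sets \<beta> = sets borel"
      by (simp_all add: \<alpha>_def \<beta>_def)
    have int\<gamma>1: "(\<integral>\<^sup>+z. f z \<partial>\<gamma>1) = (\<integral>\<^sup>+z. ennreal (1 - r (snd z)) * f z \<partial>\<gamma>)"
      if [measurable]: "f \<in> borel_measurable (borel \<Otimes>\<^sub>M borel)" for f
      unfolding \<gamma>1_def by (rule nn_integral_density) (simp_all add: m\<gamma>)
    have int\<alpha>: "(\<integral>\<^sup>+v. f v \<partial>\<alpha>) = (\<integral>\<^sup>+z. ennreal (r (snd z)) * f (fst z) \<partial>\<gamma>)"
      if [measurable]: "f \<in> borel_measurable borel" for f
      unfolding \<alpha>_def by (subst nn_integral_distr) (simp_all add: nn_integral_density m\<gamma>)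
    have int\<beta>: "(\<integral>\<^sup>+w. f w \<partial>\<beta>) = (\<integral>\<^sup>+w. ennreal (max 0 (F w - G w)) * f w \<partial>lborel)"
      if [measurable]: "f \<in> borel_measurable borel" for f
      unfolding \<beta>_def by (rule nn_integral_density) simp_all
    have em\<alpha>: "emeasure \<alpha> (space \<alpha>) = \<epsilon>"
    proof -
      have "emeasure \<alpha> (space \<alpha>) = (\<integral>\<^sup>+v. 1 \<partial>\<alpha>)" by simp
      also have "\<dots> = (\<integral>\<^sup>+z. ennreal (r (snd z)) \<partial>\<gamma>)" by (subst int\<alpha>) simp_all
      also have "\<dots> = (\<integral>\<^sup>+w. ennreal (G w) * ennreal (r w) \<partial>lborel)"
        by (rule nn_integral_coupling_snd[OF \<gamma>]) simp_all
      finally show ?thesis using Gn r by (simp add: \<epsilon>' ennreal_mult[symmetric])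
    qed
    have em\<beta>: "emeasure \<beta> (space \<beta>) = \<epsilon>"
      by (simp add: \<beta>_def emeasure_density \<epsilon>_def)
    interpret \<alpha>: finite_measure \<alpha>
      by (rule finite_measureI) (use em\<alpha> \<epsilon>_le in \<open>auto simp: top_unique\<close>)
    interpret \<beta>: finite_measure \<beta>
      by (rule finite_measureI) (use em\<beta> \<epsilon>_le in \<open>auto simp: top_unique\<close>)
    have cancel: "inverse \<epsilon> * (\<epsilon> * x) = x" for x
    proof -
      have "\<epsilon> \<noteq> top" using \<epsilon>_le by (auto simp: top_unique)
      then have "inverse \<epsilon> * \<epsilon> = 1"
        using False by (simp add: divide_ennreal_def[symmetric] mult.commute[of "inverse \<epsilon>"] ennreal_divide_self zero_less_iff_neq_zero less_top[symmetric])
      then show ?thesis by (simp add: mult.assoc[symmetric])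
    qed
    have intP_fst: "(\<integral>\<^sup>+z. f (fst z) \<partial>(\<alpha> \<Otimes>\<^sub>M \<beta>)) = \<epsilon> * (\<integral>\<^sup>+v. f v \<partial>\<alpha>)"
      if [measurable]: "f \<in> borel_measurable borel" for f
      by (subst \<beta>.nn_integral_fst[symmetric]) (simp_all add: em\<beta> nn_integral_cmult mult.commute[of _ \<epsilon>])
    have intP_snd: "(\<integral>\<^sup>+z. f (snd z) \<partial>(\<alpha> \<Otimes>\<^sub>M \<beta>)) = \<epsilon> * (\<integral>\<^sup>+v. f v \<partial>\<beta>)"
      if [measurable]: "f \<in> borel_measurable borel" for f
      by (subst \<beta>.nn_integral_fst[symmetric]) (simp_all add: em\<alpha> mult.commute[of _ \<epsilon>])
    \<comment> \<open>The product of two measures of mass \<open>\<epsilon>\<close> has as marginals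
      \<open>\<epsilon>\<close> times \<open>\<alpha>\<close> and \<open>\<epsilon>\<close> times
      \<open>\<beta>\<close>, hence the factor \<open>inverse \<epsilon>\<close>.\<close>
    define \<gamma>' where "\<gamma>' = add_measures \<gamma>1 (scale_measure (inverse \<epsilon>) (\<alpha> \<Otimes>\<^sub>M \<beta>))"
    have sP: "sets (\<alpha> \<Otimes>\<^sub>M \<beta>) = sets (borel \<Otimes>\<^sub>M borel)"
      by (intro sets_pair_measure_cong sets\<alpha>\<beta>)
    have mP: "measurable (\<alpha> \<Otimes>\<^sub>M \<beta>) N = measurable (borel \<Otimes>\<^sub>M borel) N" for N :: "'b measure"
      by (intro measurable_cong_sets sP refl)
    have s\<gamma>1: "sets \<gamma>1 = sets (borel \<Otimes>\<^sub>M borel)" by (simp add: \<gamma>1_def s\<gamma>)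
    have m\<gamma>1: "measurable \<gamma>1 N = measurable (borel \<Otimes>\<^sub>M borel) N" for N :: "'b measure"
      by (intro measurable_cong_sets s\<gamma>1 refl)
    have int\<gamma>': "(\<integral>\<^sup>+z. f z \<partial>\<gamma>') = (\<integral>\<^sup>+z. ennreal (1 - r (snd z)) * f z \<partial>\<gamma>) + inverse \<epsilon> * (\<integral>\<^sup>+z. f z \<partial>(\<alpha> \<Otimes>\<^sub>M \<beta>))"
      if [measurable]: "f \<in> borel_measurable (borel \<Otimes>\<^sub>M borel)" for f
      unfolding \<gamma>'_def
      by (subst nn_integral_add_measures) (simp_all add: s\<gamma>1 sP m\<gamma>1 mP int\<gamma>1 nn_integral_scale_measure)
    have split_r: "ennreal (1 - r w) * x + ennreal (r w) * x = x" for w x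
      using r(1,2)[of w] by (simp add: distrib_right[symmetric] ennreal_plus[symmetric] del: ennreal_plus)
    have shrink: "ennreal s * x \<le> x" if "s \<le> 1" for s x
      using mult_right_mono[of "ennreal s" 1 x] that by (simp add: ennreal_le_1)
    have "\<gamma>' \<in> couplings F\<^sub>0 F"
    proof (rule couplingI)
      show "sets \<gamma>' = sets (borel \<Otimes>\<^sub>M borel)" by (simp add: \<gamma>'_def s\<gamma>1)
    next
      fix A :: "'a set" assume [measurable]: "A \<in> sets borel"
      have "(\<integral>\<^sup>+z. indicator A (fst z) \<partial>\<gamma>') = (\<integral>\<^sup>+z. ennreal (1 - r (snd z)) * indicator A (fst z) \<partial>\<gamma>)
          + (\<integral>\<^sup>+z. ennreal (r (snd z)) * indicator A (fst z) \<partial>\<gamma>)"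
        by (subst int\<gamma>') (simp_all add: intP_fst cancel int\<alpha> del: nn_integral_indicator)
      also have "\<dots> = (\<integral>\<^sup>+z. indicator A (fst z) \<partial>\<gamma>)"
        by (subst nn_integral_add[symmetric]) (simp_all add: m\<gamma> split_r)
      finally show "(\<integral>\<^sup>+z. indicator A (fst z) \<partial>\<gamma>') = (\<integral>\<^sup>+v. ennreal (F\<^sub>0 v) * indicator A v \<partial>lborel)"
        by (simp add: nn_integral_coupling_fst[OF \<gamma>])
      have "(\<integral>\<^sup>+z. indicator A (snd z) \<partial>\<gamma>') = (\<integral>\<^sup>+z. ennreal (1 - r (snd z)) * indicator A (snd z) \<partial>\<gamma>)
          + (\<integral>\<^sup>+w. ennreal (max 0 (F w - G w)) * indicator A w \<partial>lborel)"
        by (subst int\<gamma>') (simp_all add: intP_snd cancel int\<beta> del: nn_integral_indicator)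
      also have "(\<integral>\<^sup>+z. ennreal (1 - r (snd z)) * indicator A (snd z) \<partial>\<gamma>)
          = (\<integral>\<^sup>+w. ennreal (G w) * (ennreal (1 - r w) * indicator A w) \<partial>lborel)"
        by (rule nn_integral_coupling_snd[OF \<gamma>]) simp_all
      also have "\<dots> + (\<integral>\<^sup>+w. ennreal (max 0 (F w - G w)) * indicator A w \<partial>lborel)
          = (\<integral>\<^sup>+w. ennreal (G w) * (ennreal (1 - r w) * indicator A w) + ennreal (max 0 (F w - G w)) * indicator A w \<partial>lborel)"
        by (subst nn_integral_add) simp_all
      also have "\<dots> = (\<integral>\<^sup>+w. ennreal (F w) * indicator A w \<partial>lborel)"
      proof (intro nn_integral_cong)
        fix w
        have "G w * (1 - r w) + max 0 (F w - G w) = F w" using r(3)[of w] by (auto simp: algebra_simps max_def split: if_splits)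
        then have "ennreal (G w) * ennreal (1 - r w) + ennreal (max 0 (F w - G w)) = ennreal (F w)"
          using Gn r by (simp add: ennreal_mult[symmetric] ennreal_plus[symmetric] del: ennreal_plus)
        then show "ennreal (G w) * (ennreal (1 - r w) * indicator A w) + ennreal (max 0 (F w - G w)) * indicator A w = ennreal (F w) * indicator A w"
          by (simp add: mult.assoc[symmetric] distrib_right[symmetric])
      qed
      finally show "(\<integral>\<^sup>+z. indicator A (snd z) \<partial>\<gamma>') = (\<integral>\<^sup>+w. ennreal (F w) * indicator A w \<partial>lborel)" .
    qed simp_all
    moreover have "(\<integral>\<^sup>+z. c z \<partial>\<gamma>') \<le> (\<integral>\<^sup>+z. c z \<partial>\<gamma>) + (R * \<epsilon>
        + (\<integral>\<^sup>+v. ennreal (F\<^sub>0 v) * (a v * indicator {v. R < a v} v) \<partial>lborel)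
        + (\<integral>\<^sup>+w. ennreal (F w) * b w \<partial>lborel))"
    proof -
      have 1: "(\<integral>\<^sup>+z. ennreal (1 - r (snd z)) * c z \<partial>\<gamma>) \<le> (\<integral>\<^sup>+z. c z \<partial>\<gamma>)"
        using r by (intro nn_integral_mono) (auto intro!: shrink)
      have 2: "inverse \<epsilon> * (\<integral>\<^sup>+z. c z \<partial>(\<alpha> \<Otimes>\<^sub>M \<beta>)) \<le> inverse \<epsilon> * (\<integral>\<^sup>+z. a (fst z) + b (snd z) \<partial>(\<alpha> \<Otimes>\<^sub>M \<beta>))"
        by (intro mult_left_mono nn_integral_mono) (use cost in auto)
      have 3: "inverse \<epsilon> * (\<integral>\<^sup>+z. a (fst z) + b (snd z) \<partial>(\<alpha> \<Otimes>\<^sub>M \<beta>)) = (\<integral>\<^sup>+v. a v \<partial>\<alpha>) + (\<integral>\<^sup>+w. b w \<partial>\<beta>)"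
        by (simp add: nn_integral_add mP intP_fst intP_snd distrib_left cancel)
      have 4: "(\<integral>\<^sup>+w. b w \<partial>\<beta>) \<le> (\<integral>\<^sup>+w. ennreal (F w) * b w \<partial>lborel)"
        unfolding int\<beta>[OF \<open>b \<in> borel_measurable borel\<close>]
        by (intro nn_integral_mono mult_right_mono ennreal_leI) (use Fn Gn in \<open>auto simp: max_def\<close>)
      \<comment> \<open>Values of \<open>a\<close> up to the threshold \<open>R\<close> cost at most
        \<open>R * \<epsilon>\<close>; above it, \<open>\<alpha>\<close> is dominated by the first
        marginal of \<open>\<gamma>\<close>, which is \<open>F\<^sub>0\<close>. Truncation makes a
        small \<open>\<epsilon>\<close> useful even for unbounded \<open>a\<close>.\<close>
      have 5: "(\<integral>\<^sup>+v. a v \<partial>\<alpha>) \<le> R * \<epsilon> + (\<integral>\<^sup>+v. ennreal (F\<^sub>0 v) * (a v * indicator {v. R < a v} v) \<partial>lborel)"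
      proof -
        have "(\<integral>\<^sup>+v. a v \<partial>\<alpha>) \<le> (\<integral>\<^sup>+v. R + a v * indicator {v. R < a v} v \<partial>\<alpha>)"
          by (intro nn_integral_mono) (auto split: split_indicator)
        also have "\<dots> = R * \<epsilon> + (\<integral>\<^sup>+v. a v * indicator {v. R < a v} v \<partial>\<alpha>)"
          by (simp add: nn_integral_add em\<alpha>)
        also have "(\<integral>\<^sup>+v. a v * indicator {v. R < a v} v \<partial>\<alpha>)
            \<le> (\<integral>\<^sup>+z. a (fst z) * indicator {v. R < a v} (fst z) \<partial>\<gamma>)"
          by (subst int\<alpha>, simp) (use r in \<open>auto intro!: nn_integral_mono shrink\<close>)
        also have "\<dots> = (\<integral>\<^sup>+v. ennreal (F\<^sub>0 v) * (a v * indicator {v. R < a v} v) \<partial>lborel)"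
          by (rule nn_integral_coupling_fst[OF \<gamma>]) simp_all
        finally show ?thesis by simp
      qed
      show ?thesis
        using add_mono[OF 1 order_trans[OF 2[unfolded 3] add_mono[OF 5 4]]] by (subst int\<gamma>') simp_all
    qed
    ultimately show thesis using that unfolding \<epsilon>_def by blast
  qed
qed

subsection \<open>Second moments and correlations\<close>

definition second_moment :: "'a::euclidean_space \<Rightarrow> ('a \<Rightarrow> real) \<Rightarrow> real" where
  "second_moment c F = (\<integral>v. (norm (v - c))\<^sup>2 * F v \<partial>lborel)"

lemma norm_diff_sq_le: "(norm (v - c))\<^sup>2 \<le> 2 * (norm v)\<^sup>2 + 2 * (norm c)\<^sup>2" for v c :: "'a::euclidean_space"
proof -
  have "(norm (v - c))\<^sup>2 \<le> (norm v + norm c)\<^sup>2" by (intro power_mono norm_triangle_ineq4) auto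
  also have "\<dots> \<le> 2 * (norm v)\<^sup>2 + 2 * (norm c)\<^sup>2"
    using sum_squares_bound[of "norm v" "norm c"] by (simp add: power2_sum)
  finally show ?thesis .
qed

lemma prob_densities_integrable:
  fixes F :: "'a::euclidean_space \<Rightarrow> real"
  assumes F: "F \<in> prob_densities"
  shows "integrable lborel F" "(\<integral>v. F v \<partial>lborel) = 1"
    "integrable lborel (\<lambda>v. (norm (v - c))\<^sup>2 * F v)"
    "integrable lborel (\<lambda>v. F v *\<^sub>R v)"
proof -
  note [measurable] = F[THEN prob_densities_measurable]
  have nn: "\<And>v. 0 \<le> F v" using F by (rule prob_densities_nonneg)
  show i: "integrable lborel F"
    using F nn by (intro integrableI_nonneg) (auto simp: prob_densities_def)
  show "(\<integral>v. F v \<partial>lborel) = 1"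
    using F nn by (subst integral_eq_nn_integral) (auto simp: prob_densities_nn_integral)
  have i0: "integrable lborel (\<lambda>v. (norm v)\<^sup>2 * F v)"
    using F nn by (intro integrableI_nonneg) (auto simp: prob_densities_def)
  have m: "integrable lborel (\<lambda>v. 2 * ((norm v)\<^sup>2 * F v) + 2 * (norm c)\<^sup>2 * F v)"
    using i i0 by simp
  show "integrable lborel (\<lambda>v. (norm (v - c))\<^sup>2 * F v)"
  proof (rule Bochner_Integration.integrable_bound[OF m])
    show "AE v in lborel. norm ((norm (v - c))\<^sup>2 * F v) \<le> norm (2 * ((norm v)\<^sup>2 * F v) + 2 * (norm c)\<^sup>2 * F v)"
    proof (rule AE_I2)
      fix v
      have "(norm (v - c))\<^sup>2 * F v \<le> (2 * (norm v)\<^sup>2 + 2 * (norm c)\<^sup>2) * F v"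
        using norm_diff_sq_le nn by (rule mult_right_mono)
      then show "norm ((norm (v - c))\<^sup>2 * F v) \<le> norm (2 * ((norm v)\<^sup>2 * F v) + 2 * (norm c)\<^sup>2 * F v)"
        using nn[of v] by (simp add: algebra_simps)
    qed
  qed simp
  show "integrable lborel (\<lambda>v. F v *\<^sub>R v)"
  proof (rule Bochner_Integration.integrable_bound[OF Bochner_Integration.integrable_add[OF i i0]])
    show "AE v in lborel. norm (F v *\<^sub>R v) \<le> norm (F v + (norm v)\<^sup>2 * F v)"
    proof (rule AE_I2)
      fix v :: 'a
      have "norm v \<le> 1 + (norm v)\<^sup>2"
        using sum_squares_bound[of 1 "norm v"] by (simp add: power2_eq_square) (smt (verit) norm_ge_zero)
      then have "F v * norm v \<le> F v * (1 + (norm v)\<^sup>2)" using nn by (rule mult_left_mono)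
      then show "norm (F v *\<^sub>R v) \<le> norm (F v + (norm v)\<^sup>2 * F v)"
        using nn[of v] by (simp add: algebra_simps)
    qed
  qed simp
qed

lemma second_moment_nonneg: "F \<in> prob_densities \<Longrightarrow> 0 \<le> second_moment c F"
  unfolding second_moment_def by (intro integral_nonneg_AE) (auto simp: prob_densities_nonneg)

lemma nn_integral_second_moment:
  assumes "F \<in> prob_densities"
  shows "(\<integral>\<^sup>+v. ennreal ((norm (v - c))\<^sup>2 * F v) \<partial>lborel) = ennreal (second_moment c F)"
  unfolding second_moment_def
  by (rule nn_integral_eq_integral) (use assms in \<open>auto simp: prob_densities_integrable prob_densities_nonneg\<close>)

text \<open>A density cannot concentrate at one point, since points are Lebesgue null. Positivity is
  what allows the dilation factor to be defined by a quotient.\<close>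

lemma second_moment_pos:
  fixes F :: "'a::euclidean_space \<Rightarrow> real"
  assumes F: "F \<in> prob_densities"
  shows "0 < second_moment c F"
proof -
  note [measurable] = F[THEN prob_densities_measurable]
  have "second_moment c F \<noteq> 0"
  proof
    assume "second_moment c F = 0"
    then have "AE v in lborel. (norm (v - c))\<^sup>2 * F v = 0"
      unfolding second_moment_def
      by (subst (asm) integral_nonneg_eq_0_iff_AE) (use F in \<open>auto simp: prob_densities_integrable prob_densities_nonneg\<close>)
    moreover have "AE v in lborel. v \<noteq> c" by (rule AE_lborel_singleton)
    ultimately have "AE v in lborel. F v = 0" by eventually_elim auto
    then have "(\<integral>v. F v \<partial>lborel) = (\<integral>v. 0 \<partial>(lborel::'a measure))" by (intro integral_cong_AE) auto
    then show False using F by (simp add: prob_densities_integrable)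
  qed
  then show ?thesis using second_moment_nonneg[OF F, of c] by simp
qed

lemma fixed_moment_densities_iff:
  fixes u :: "'a::euclidean_space" and \<theta> :: real
  shows "F \<in> fixed_moment_densities u \<theta> \<longleftrightarrow>
    F \<in> prob_densities \<and> second_moment u F = DIM('a) * \<theta> \<and> (\<integral>v. F v *\<^sub>R v \<partial>lborel) = u"
  by (auto simp: fixed_moment_densities_def second_moment_def field_simps)

lemma prob_densitiesI:
  fixes F :: "'a::euclidean_space \<Rightarrow> real"
  assumes [measurable]: "F \<in> borel_measurable borel" and nn: "\<And>v. 0 \<le> F v"
    and one: "(\<integral>\<^sup>+v. ennreal (F v) \<partial>lborel) = 1"
    and fin: "(\<integral>\<^sup>+v. ennreal ((norm (v - c))\<^sup>2 * F v) \<partial>lborel) < \<infinity>"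
  shows "F \<in> prob_densities"
proof -
  have "(\<integral>\<^sup>+v. ennreal ((norm v)\<^sup>2 * F v) \<partial>lborel)
    \<le> (\<integral>\<^sup>+v. 2 * ennreal ((norm (v - c))\<^sup>2 * F v) + ennreal (2 * (norm c)\<^sup>2) * ennreal (F v) \<partial>lborel)"
  proof (rule nn_integral_mono)
    fix v
    have "(norm v)\<^sup>2 * F v \<le> (2 * (norm (v - c))\<^sup>2 + 2 * (norm c)\<^sup>2) * F v"
      using norm_diff_sq_le[of "v - c" "- c"] nn by (intro mult_right_mono) auto
    also have "\<dots> = 2 * ((norm (v - c))\<^sup>2 * F v) + (2 * (norm c)\<^sup>2) * F v" by (simp add: algebra_simps)
    finally show "ennreal ((norm v)\<^sup>2 * F v) \<le> 2 * ennreal ((norm (v - c))\<^sup>2 * F v) + ennreal (2 * (norm c)\<^sup>2) * ennreal (F v)"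
      using nn[of v] by (simp add: ennreal_mult[symmetric] ennreal_plus[symmetric] ennreal_leI flip: ennreal_numeral del: ennreal_plus)
  qed
  also have "\<dots> = 2 * (\<integral>\<^sup>+v. ennreal ((norm (v - c))\<^sup>2 * F v) \<partial>lborel) + ennreal (2 * (norm c)\<^sup>2)"
    by (simp add: nn_integral_add nn_integral_cmult one)
  also have "\<dots> < \<infinity>" using fin by (simp add: ennreal_mult_less_top)
  finally show ?thesis using nn one by (simp add: prob_densities_def)
qed

lemma integral_centered:
  fixes F :: "'a::euclidean_space \<Rightarrow> real"
  assumes "F \<in> prob_densities" "(\<integral>v. F v *\<^sub>R v \<partial>lborel) = m"
  shows "integrable lborel (\<lambda>v. F v *\<^sub>R (v - c))" "(\<integral>v. F v *\<^sub>R (v - c) \<partial>lborel) = m - c"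
  using assms prob_densities_integrable[OF assms(1)] by (simp_all add: scaleR_diff_right)

text \<open>When the square is expanded about the mean, the cross term integrates to zero and leaves
  the surplus \<open>(norm (m - c))\<^sup>2\<close>. A bound on the second moment about
  \<open>u\<close> thereby becomes one about the mean of the limit density.\<close>

lemma second_moment_mean_le:
  assumes F: "F \<in> prob_densities" and m: "(\<integral>v. F v *\<^sub>R v \<partial>lborel) = m"
  shows "second_moment m F \<le> second_moment c F"
proof -
  have "second_moment c F = (\<integral>v. (norm (v - m))\<^sup>2 * F v + (F v *\<^sub>R (v - m)) \<bullet> (2 *\<^sub>R (m - c)) + (norm (m - c))\<^sup>2 * F v \<partial>lborel)"
    unfolding second_moment_def
  proof (intro Bochner_Integration.integral_cong refl)
    fix v
    have "(norm (v - c))\<^sup>2 = (norm (v - m + (m - c)))\<^sup>2" by simp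
    also have "\<dots> = (norm (v - m))\<^sup>2 + 2 * ((v - m) \<bullet> (m - c)) + (norm (m - c))\<^sup>2"
      by (simp only: power2_norm_eq_inner inner_add_left inner_add_right inner_commute[of "m - c" "v - m"])
    finally have *: "(norm (v - c))\<^sup>2 = (norm (v - m))\<^sup>2 + 2 * ((v - m) \<bullet> (m - c)) + (norm (m - c))\<^sup>2" .
    show "(norm (v - c))\<^sup>2 * F v = (norm (v - m))\<^sup>2 * F v + (F v *\<^sub>R (v - m)) \<bullet> (2 *\<^sub>R (m - c)) + (norm (m - c))\<^sup>2 * F v"
      unfolding * by (simp add: distrib_left distrib_right mult.left_commute mult.commute[of _ "F v"])
  qed
  also have "\<dots> = second_moment m F + (norm (m - c))\<^sup>2"
    using prob_densities_integrable[OF F] integral_centered[OF F m, of m] unfolding second_moment_def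
    by (simp del: inner_scaleR_left inner_scaleR_right)
  finally show ?thesis by simp
qed

lemma
  fixes f :: "'a::euclidean_space \<Rightarrow> 'b::{banach, second_countable_topology}"
  assumes \<gamma>: "\<gamma> \<in> couplings F\<^sub>0 F\<^sub>1" and F: "F\<^sub>0 \<in> prob_densities" "F\<^sub>1 \<in> prob_densities"
    and [measurable]: "f \<in> borel_measurable borel"
  shows integrable_coupling_fst: "integrable \<gamma> (\<lambda>z. f (fst z)) \<longleftrightarrow> integrable lborel (\<lambda>v. F\<^sub>0 v *\<^sub>R f v)"
    and integrable_coupling_snd: "integrable \<gamma> (\<lambda>z. f (snd z)) \<longleftrightarrow> integrable lborel (\<lambda>v. F\<^sub>1 v *\<^sub>R f v)"
    and integral_coupling_fst: "(\<integral>z. f (fst z) \<partial>\<gamma>) = (\<integral>v. F\<^sub>0 v *\<^sub>R f v \<partial>lborel)"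
    and integral_coupling_snd: "(\<integral>z. f (snd z) \<partial>\<gamma>) = (\<integral>v. F\<^sub>1 v *\<^sub>R f v \<partial>lborel)"
proof -
  note [measurable] = F[THEN prob_densities_measurable]
  note nn = F[THEN prob_densities_nonneg]
  have d: "distr \<gamma> borel fst = density lborel (\<lambda>v. ennreal (F\<^sub>0 v))"
    "distr \<gamma> borel snd = density lborel (\<lambda>v. ennreal (F\<^sub>1 v))"
    using \<gamma> by (auto simp: couplings_def)
  have meas: "fst \<in> measurable \<gamma> (borel :: 'a measure)" "snd \<in> measurable \<gamma> (borel :: 'a measure)"
    by (simp_all add: coupling_measurable[OF \<gamma>])
  show "integrable \<gamma> (\<lambda>z. f (fst z)) \<longleftrightarrow> integrable lborel (\<lambda>v. F\<^sub>0 v *\<^sub>R f v)"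
    "integrable \<gamma> (\<lambda>z. f (snd z)) \<longleftrightarrow> integrable lborel (\<lambda>v. F\<^sub>1 v *\<^sub>R f v)"
    by (subst integrable_distr_eq[symmetric, OF meas(1)] integrable_distr_eq[symmetric, OF meas(2)];
        simp add: d integrable_density nn)+
  show "(\<integral>z. f (fst z) \<partial>\<gamma>) = (\<integral>v. F\<^sub>0 v *\<^sub>R f v \<partial>lborel)"
    "(\<integral>z. f (snd z) \<partial>\<gamma>) = (\<integral>v. F\<^sub>1 v *\<^sub>R f v \<partial>lborel)"
    by (subst integral_distr[symmetric, OF meas(1)] integral_distr[symmetric, OF meas(2)];
        simp add: d integral_density nn)+
qed

section \<open>Correlation of a coupling\<close>

definition correlation :: "'a::euclidean_space \<Rightarrow> 'a \<Rightarrow> ('a \<times> 'a) measure \<Rightarrow> real" where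
  "correlation a b \<gamma> = (\<integral>z. (fst z - a) \<bullet> (snd z - b) \<partial>\<gamma>)"

lemma integrable_correlation:
  fixes F\<^sub>0 F\<^sub>1 :: "'a::euclidean_space \<Rightarrow> real"
  assumes \<gamma>: "\<gamma> \<in> couplings F\<^sub>0 F\<^sub>1" and F: "F\<^sub>0 \<in> prob_densities" "F\<^sub>1 \<in> prob_densities"
  shows "integrable \<gamma> (\<lambda>z. (norm (fst z - a))\<^sup>2)" "integrable \<gamma> (\<lambda>z. (norm (snd z - b))\<^sup>2)"
    "integrable \<gamma> (\<lambda>z. (fst z - a) \<bullet> (snd z - b))"
proof -
  show i0: "integrable \<gamma> (\<lambda>z. (norm (fst z - a))\<^sup>2)"
    using integrable_coupling_fst[OF \<gamma> F, of "\<lambda>v. (norm (v - a))\<^sup>2"] prob_densities_integrable(3)[OF F(1)]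
    by (simp add: mult.commute)
  show i1: "integrable \<gamma> (\<lambda>z. (norm (snd z - b))\<^sup>2)"
    using integrable_coupling_snd[OF \<gamma> F, of "\<lambda>v. (norm (v - b))\<^sup>2"] prob_densities_integrable(3)[OF F(2)]
    by (simp add: mult.commute)
  show "integrable \<gamma> (\<lambda>z. (fst z - a) \<bullet> (snd z - b))"
  proof (rule Bochner_Integration.integrable_bound[OF Bochner_Integration.integrable_add[OF i0 i1]])
    show "AE z in \<gamma>. norm ((fst z - a) \<bullet> (snd z - b)) \<le> norm ((norm (fst z - a))\<^sup>2 + (norm (snd z - b))\<^sup>2)"
    proof (rule AE_I2)
      fix z :: "'a \<times> 'a"
      show "norm ((fst z - a) \<bullet> (snd z - b)) \<le> norm ((norm (fst z - a))\<^sup>2 + (norm (snd z - b))\<^sup>2)"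
        using Cauchy_Schwarz_ineq2[of "fst z - a" "snd z - b"] sum_squares_bound[of "norm (fst z - a)" "norm (snd z - b)"]
        by (simp add: power2_eq_square)
    qed
  qed (simp add: coupling_measurable[OF \<gamma>])
qed

text \<open>One expansion of the weighted square covers every cost that occurs: weights 1 and 1 give
  the Wasserstein cost, 1 and \<open>c\<close> the cost after dilation, and \<open>p\<close>,
  \<open>q\<close> with \<open>p * q = 1\<close> the perturbation estimate. The second claim allows
  comparisons of \<open>ennreal\<close> values to be read as comparisons of reals.\<close>

lemma transport_cost_eq:
  fixes F\<^sub>0 F\<^sub>1 :: "'a::euclidean_space \<Rightarrow> real"
  assumes \<gamma>: "\<gamma> \<in> couplings F\<^sub>0 F\<^sub>1" and F: "F\<^sub>0 \<in> prob_densities" "F\<^sub>1 \<in> prob_densities"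
  shows "(\<integral>\<^sup>+z. ennreal (1/2 * (norm (p *\<^sub>R (fst z - a) - q *\<^sub>R (snd z - b)))\<^sup>2) \<partial>\<gamma>)
    = ennreal (1/2 * p\<^sup>2 * second_moment a F\<^sub>0 + 1/2 * q\<^sup>2 * second_moment b F\<^sub>1 - p * q * correlation a b \<gamma>)"
    and "0 \<le> 1/2 * p\<^sup>2 * second_moment a F\<^sub>0 + 1/2 * q\<^sup>2 * second_moment b F\<^sub>1 - p * q * correlation a b \<gamma>"
proof -
  note i = integrable_correlation[OF assms]
  have "1/2 * (norm (p *\<^sub>R x - q *\<^sub>R y))\<^sup>2 = 1/2 * p\<^sup>2 * (norm x)\<^sup>2 + 1/2 * q\<^sup>2 * (norm y)\<^sup>2 - p * q * (x \<bullet> y)"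
    for x y :: 'a
    unfolding power2_norm_eq_inner inner_diff_left inner_diff_right
    by (simp add: inner_commute[of y x] power2_eq_square field_simps)
  note eq = this[of "fst _ - a" "snd _ - b"]
  have "second_moment a F\<^sub>0 = (\<integral>z. (norm (fst z - a))\<^sup>2 \<partial>\<gamma>)" "second_moment b F\<^sub>1 = (\<integral>z. (norm (snd z - b))\<^sup>2 \<partial>\<gamma>)"
    using integral_coupling_fst[OF \<gamma> F, of "\<lambda>v. (norm (v - a))\<^sup>2"] integral_coupling_snd[OF \<gamma> F, of "\<lambda>v. (norm (v - b))\<^sup>2"]
    by (simp_all add: second_moment_def mult.commute)
  then have *: "(\<integral>z. 1/2 * (norm (p *\<^sub>R (fst z - a) - q *\<^sub>R (snd z - b)))\<^sup>2 \<partial>\<gamma>)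
    = 1/2 * p\<^sup>2 * second_moment a F\<^sub>0 + 1/2 * q\<^sup>2 * second_moment b F\<^sub>1 - p * q * correlation a b \<gamma>"
    unfolding eq correlation_def by (simp add: i)
  have "integrable \<gamma> (\<lambda>z. 1/2 * (norm (p *\<^sub>R (fst z - a) - q *\<^sub>R (snd z - b)))\<^sup>2)"
    unfolding eq by (simp add: i)
  then show "(\<integral>\<^sup>+z. ennreal (1/2 * (norm (p *\<^sub>R (fst z - a) - q *\<^sub>R (snd z - b)))\<^sup>2) \<partial>\<gamma>)
    = ennreal (1/2 * p\<^sup>2 * second_moment a F\<^sub>0 + 1/2 * q\<^sup>2 * second_moment b F\<^sub>1 - p * q * correlation a b \<gamma>)"
    unfolding *[symmetric] by (rule nn_integral_eq_integral) simp
  show "0 \<le> 1/2 * p\<^sup>2 * second_moment a F\<^sub>0 + 1/2 * q\<^sup>2 * second_moment b F\<^sub>1 - p * q * correlation a b \<gamma>"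
    unfolding *[symmetric] by (intro integral_nonneg_AE) auto
qed

text \<open>\<open>fst z - a\<close> integrates to zero, so moving the centre of the second variable
  adds only the inner product of zero with a constant. The limit density can thus be centred at its
  own mean while correlations are measured about \<open>u\<close>.\<close>

lemma correlation_recenter:
  fixes F\<^sub>0 F\<^sub>1 :: "'a::euclidean_space \<Rightarrow> real"
  assumes \<gamma>: "\<gamma> \<in> couplings F\<^sub>0 F\<^sub>1" and F: "F\<^sub>0 \<in> prob_densities" "F\<^sub>1 \<in> prob_densities"
    and m: "(\<integral>v. F\<^sub>0 v *\<^sub>R v \<partial>lborel) = a"
  shows "correlation a b \<gamma> = correlation a c \<gamma>"
proof -
  have i: "integrable \<gamma> (\<lambda>z. fst z - a)" "(\<integral>z. fst z - a \<partial>\<gamma>) = 0"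
    using integrable_coupling_fst[OF \<gamma> F, of "\<lambda>v. v - a"] integral_coupling_fst[OF \<gamma> F, of "\<lambda>v. v - a"]
      integral_centered[OF F(1) m, of a] by simp_all
  have "correlation a b \<gamma> = (\<integral>z. (fst z - a) \<bullet> (snd z - c) + (fst z - a) \<bullet> (c - b) \<partial>\<gamma>)"
    unfolding correlation_def by (simp add: inner_add_right[symmetric])
  also have "\<dots> = correlation a c \<gamma> + (\<integral>z. (fst z - a) \<bullet> (c - b) \<partial>\<gamma>)"
    unfolding correlation_def
    by (intro Bochner_Integration.integral_add integrable_correlation[OF \<gamma> F] integrable_inner_left) (auto simp: i)
  also have "(\<integral>z. (fst z - a) \<bullet> (c - b) \<partial>\<gamma>) = 0"
    using i by simp
  finally show ?thesis by simp
qed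

text \<open>By Fubini, the integral over the second variable pairs \<open>v - a\<close> with the
  mean of \<open>w - b\<close>, which is zero.\<close>

lemma correlation_product:
  fixes F\<^sub>0 F\<^sub>1 :: "'a::euclidean_space \<Rightarrow> real"
  assumes F: "F\<^sub>0 \<in> prob_densities" "F\<^sub>1 \<in> prob_densities"
    and m: "(\<integral>v. F\<^sub>1 v *\<^sub>R v \<partial>lborel) = b"
  shows "correlation a b (density lborel (\<lambda>v. ennreal (F\<^sub>0 v)) \<Otimes>\<^sub>M density lborel (\<lambda>v. ennreal (F\<^sub>1 v))) = 0"
    (is "correlation a b (?M \<Otimes>\<^sub>M ?N) = 0")
proof -
  note [measurable] = F[THEN prob_densities_measurable]
  interpret M: prob_space ?M by (rule prob_space_prob_densities[OF F(1)])
  interpret N: prob_space ?N by (rule prob_space_prob_densities[OF F(2)])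
  interpret P: pair_sigma_finite ?M ?N ..
  have i: "integrable (?M \<Otimes>\<^sub>M ?N) (\<lambda>z. (fst z - a) \<bullet> (snd z - b))"
    by (rule integrable_correlation[OF product_coupling[OF F] F])
  have i': "integrable ?N (\<lambda>w. w - b)" and z: "(\<integral>w. w - b \<partial>?N) = 0"
    using integral_centered[OF F(2) m, of b] by (simp_all add: integrable_density integral_density prob_densities_nonneg[OF F(2)])
  have "correlation a b (?M \<Otimes>\<^sub>M ?N) = (\<integral>v. (\<integral>w. (v - a) \<bullet> (w - b) \<partial>?N) \<partial>?M)"
    unfolding correlation_def by (subst P.integral_fst'[symmetric]) (simp_all add: i)
  also have "\<dots> = (\<integral>v. 0 \<partial>?M)"
    by (intro Bochner_Integration.integral_cong refl, subst integral_inner_right) (simp_all add: i' z)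
  finally show ?thesis by simp
qed

text \<open>Dominated convergence in the threshold: at each point the truncated integrand is
  eventually zero, and the second moment supplies the integrable bound. An integer threshold turns
  this into a sequence.\<close>

lemma second_moment_tail:
  fixes F :: "'a::euclidean_space \<Rightarrow> real"
  assumes F: "F \<in> prob_densities" and "e > 0"
  obtains R :: nat where
    "(\<integral>\<^sup>+v. ennreal (F v) * (ennreal (p * (norm (v - c))\<^sup>2) * indicator {v. ennreal R < ennreal (p * (norm (v - c))\<^sup>2)} v) \<partial>lborel) \<le> ennreal e"
proof -
  note [measurable] = F[THEN prob_densities_measurable]
  define a where "a v = ennreal (p * (norm (v - c))\<^sup>2)" for v
  have [measurable]: "a \<in> borel_measurable borel" unfolding a_def by measurable
  define f where "f R v = ennreal (F v) * (a v * indicator {v. ennreal (real R) < a v} v)" for R v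
  have "(\<lambda>R. \<integral>\<^sup>+v. f R v \<partial>lborel) \<longlonglongrightarrow> (\<integral>\<^sup>+v. 0 \<partial>(lborel :: 'a measure))"
  proof (rule nn_integral_dominated_convergence[where w="\<lambda>v. ennreal (F v) * a v"])
    show "(\<integral>\<^sup>+v. ennreal (F v) * a v \<partial>lborel) < \<infinity>"
    proof -
      have "(\<integral>\<^sup>+v. ennreal (F v) * a v \<partial>lborel) = (\<integral>\<^sup>+v. ennreal p * ennreal ((norm (v - c))\<^sup>2 * F v) \<partial>lborel)"
        using prob_densities_nonneg[OF F] unfolding a_def
        by (intro nn_integral_cong) (simp add: ennreal_mult' ennreal_mult'' ac_simps)
      also have "\<dots> = ennreal p * ennreal (second_moment c F)"
        by (simp add: nn_integral_cmult nn_integral_second_moment[OF F])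
      finally show ?thesis by (simp add: ennreal_mult_less_top)
    qed
    show "AE v in lborel. f R v \<le> ennreal (F v) * a v" for R
      by (auto simp: f_def split: split_indicator)
    show "AE v in lborel. (\<lambda>R. f R v) \<longlonglongrightarrow> 0"
    proof (rule AE_I2)
      fix v
      obtain N :: nat where "p * (norm (v - c))\<^sup>2 \<le> real N" using real_arch_simple by blast
      then have "eventually (\<lambda>R. f R v = 0) sequentially"
        unfolding f_def a_def eventually_sequentially
        by (intro exI[of _ N]) (auto simp: not_less intro!: ennreal_leI split: split_indicator)
      then show "(\<lambda>R. f R v) \<longlonglongrightarrow> 0" by (rule tendsto_eventually)
    qed
  qed (auto simp: f_def)
  then have "eventually (\<lambda>R. (\<integral>\<^sup>+v. f R v \<partial>lborel) < ennreal e) sequentially"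
    using \<open>e > 0\<close> by (intro order_tendstoD(2)) auto
  then obtain R where "(\<integral>\<^sup>+v. f R v \<partial>lborel) < ennreal e"
    by (auto simp: eventually_sequentially)
  then show thesis using that[of R] by (auto simp: f_def a_def less_imp_le)
qed

text \<open>
  The weights \<open>1 / q\<close> and \<open>q\<close> make the moment of the second variable, whose tails are not
  controlled uniformly, contribute only \<open>q\<^sup>2 * C\<close>.
\<close>

lemma correlation_perturbation:
  fixes F\<^sub>0 :: "'a::euclidean_space \<Rightarrow> real" and C \<eta> :: real
  assumes F\<^sub>0: "F\<^sub>0 \<in> prob_densities" and "0 \<le> C" and \<eta>: "\<eta> > 0"
  obtains \<delta> :: real where "\<delta> > 0"
    "\<forall>F\<in>prob_densities. \<forall>G\<in>prob_densities. second_moment u F \<le> C \<longrightarrow> second_moment u G \<le> C \<longrightarrow>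
       (\<forall>\<gamma>\<in>couplings F\<^sub>0 G. (\<integral>\<^sup>+w. ennreal (max 0 (F w - G w)) \<partial>lborel) \<le> ennreal \<delta> \<longrightarrow>
         (\<exists>\<gamma>'\<in>couplings F\<^sub>0 F. correlation u u \<gamma> \<le> correlation u u \<gamma>' + \<eta>))"
proof -
  \<comment> \<open>Chosen so that \<open>q\<^sup>2 * C\<close> is at most
    \<open>\<eta> / 4\<close>; the summand 1 keeps the quotient meaningful for
    \<open>C = 0\<close>.\<close>
  define q where "q = sqrt (\<eta> / (4 * (C + 1)))"
  have q2: "q\<^sup>2 = \<eta> / (4 * (C + 1))" unfolding q_def using \<open>0 \<le> C\<close> \<eta> by simp
  have q: "q > 0" unfolding q_def using \<open>0 \<le> C\<close> \<eta> by simp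
  have qC: "q\<^sup>2 * C \<le> \<eta> / 4" unfolding q2 using \<open>0 \<le> C\<close> \<eta> by (simp add: field_simps)
  define p where "p = 1 / q"
  have pq: "p * q = 1" using q by (simp add: p_def)
  have "\<eta> / 4 > 0" using \<eta> by simp
  from second_moment_tail[OF F\<^sub>0 this]
  obtain R :: nat where R: "(\<integral>\<^sup>+v. ennreal (F\<^sub>0 v) * (ennreal (p\<^sup>2 * (norm (v - u))\<^sup>2) * indicator {v. ennreal R < ennreal (p\<^sup>2 * (norm (v - u))\<^sup>2)} v) \<partial>lborel) \<le> ennreal (\<eta>/4)" .
  \<comment> \<open>\<open>R\<close> comes from the tail of \<open>F\<^sub>0\<close> alone, before
    \<open>F\<close>, \<open>G\<close> or a coupling is fixed, so \<open>\<delta>\<close> is uniform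
    over all of them. The summand 1 covers \<open>R = 0\<close>.\<close>
  define \<delta> where "\<delta> = \<eta> / (4 * (real R + 1))"
  have \<delta>: "\<delta> > 0" "R * \<delta> \<le> \<eta> / 4" using \<eta> by (simp_all add: \<delta>_def field_simps)
  show thesis
  proof (rule that[OF \<delta>(1)], intro ballI impI)
    fix F G \<gamma>
    assume F: "F \<in> prob_densities" and G: "G \<in> prob_densities"
      and C: "second_moment u F \<le> C" "second_moment u G \<le> C"
      and \<gamma>: "\<gamma> \<in> couplings F\<^sub>0 G"
      and close: "(\<integral>\<^sup>+w. ennreal (max 0 (F w - G w)) \<partial>lborel) \<le> ennreal \<delta>"
    note [measurable] = F[THEN prob_densities_measurable]
    have bound: "ennreal (1/2 * (norm (p *\<^sub>R (fst (v, w) - u) - q *\<^sub>R (snd (v, w) - u)))\<^sup>2)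
        \<le> ennreal (p\<^sup>2 * (norm (v - u))\<^sup>2) + ennreal (q\<^sup>2 * (norm (w - u))\<^sup>2)" for v w :: 'a
      using norm_diff_sq_le[of "p *\<^sub>R (v - u)" "q *\<^sub>R (w - u)"]
      by (simp add: ennreal_plus[symmetric] power_mult_distrib ennreal_leI del: ennreal_plus)
    have meas: "(\<lambda>z. ennreal (1/2 * (norm (p *\<^sub>R (fst z - u) - q *\<^sub>R (snd z - u)))\<^sup>2)) \<in> borel_measurable (borel \<Otimes>\<^sub>M borel)"
      "(\<lambda>v. ennreal (s * (norm (v - u))\<^sup>2)) \<in> borel_measurable borel" for s
      by measurable
    obtain \<gamma>' where \<gamma>': "\<gamma>' \<in> couplings F\<^sub>0 F"
      and le: "(\<integral>\<^sup>+z. ennreal (1/2 * (norm (p *\<^sub>R (fst z - u) - q *\<^sub>R (snd z - u)))\<^sup>2) \<partial>\<gamma>')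
        \<le> (\<integral>\<^sup>+z. ennreal (1/2 * (norm (p *\<^sub>R (fst z - u) - q *\<^sub>R (snd z - u)))\<^sup>2) \<partial>\<gamma>)
        + (ennreal R * (\<integral>\<^sup>+w. ennreal (max 0 (F w - G w)) \<partial>lborel)
        + (\<integral>\<^sup>+v. ennreal (F\<^sub>0 v) * (ennreal (p\<^sup>2 * (norm (v - u))\<^sup>2) * indicator {v. ennreal R < ennreal (p\<^sup>2 * (norm (v - u))\<^sup>2)} v) \<partial>lborel)
        + (\<integral>\<^sup>+w. ennreal (F w) * ennreal (q\<^sup>2 * (norm (w - u))\<^sup>2) \<partial>lborel))"
      by (rule coupling_surgery[OF F\<^sub>0 F G \<gamma> meas(1) meas(2)[of "p\<^sup>2"] meas(2)[of "q\<^sup>2"] bound])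
    have "(\<integral>\<^sup>+w. ennreal (F w) * ennreal (q\<^sup>2 * (norm (w - u))\<^sup>2) \<partial>lborel) = (\<integral>\<^sup>+w. ennreal (q\<^sup>2) * ennreal ((norm (w - u))\<^sup>2 * F w) \<partial>lborel)"
      using prob_densities_nonneg[OF F]
      by (intro nn_integral_cong) (simp add: ennreal_mult[symmetric] ac_simps)
    also have "\<dots> = ennreal (q\<^sup>2 * second_moment u F)"
      by (simp add: nn_integral_cmult nn_integral_second_moment[OF F] ennreal_mult second_moment_nonneg[OF F])
    finally have b: "(\<integral>\<^sup>+w. ennreal (F w) * ennreal (q\<^sup>2 * (norm (w - u))\<^sup>2) \<partial>lborel) = ennreal (q\<^sup>2 * second_moment u F)" .
    have Rd: "ennreal R * (\<integral>\<^sup>+w. ennreal (max 0 (F w - G w)) \<partial>lborel) \<le> ennreal (\<eta>/4)"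
    proof -
      have "ennreal R * (\<integral>\<^sup>+w. ennreal (max 0 (F w - G w)) \<partial>lborel) \<le> ennreal R * ennreal \<delta>"
        using close by (rule mult_left_mono) simp
      also have "\<dots> \<le> ennreal (\<eta>/4)" using \<delta> by (simp add: ennreal_mult[symmetric] ennreal_leI)
      finally show ?thesis .
    qed
    define X where "X = 1/2 * p\<^sup>2 * second_moment u F\<^sub>0"
    define Y where "Y = X + 1/2 * q\<^sup>2 * second_moment u G - correlation u u \<gamma>"
    have Y0: "Y \<ge> 0" using transport_cost_eq(2)[OF \<gamma> F\<^sub>0 G, of p u q u] by (simp add: Y_def X_def pq)
    have qF: "0 \<le> q\<^sup>2 * second_moment u F" using second_moment_nonneg[OF F] by simp
    have "ennreal (X + 1/2 * q\<^sup>2 * second_moment u F - correlation u u \<gamma>')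
        \<le> ennreal Y + (ennreal (\<eta>/4) + ennreal (\<eta>/4) + ennreal (q\<^sup>2 * second_moment u F))"
      using order_trans[OF le add_left_mono[OF add_mono[OF add_mono[OF Rd R] order_refl]]]
      unfolding transport_cost_eq(1)[OF \<gamma> F\<^sub>0 G] transport_cost_eq(1)[OF \<gamma>' F\<^sub>0 F] b pq Y_def X_def by simp
    also have "\<dots> = ennreal (Y + (\<eta>/4 + \<eta>/4 + q\<^sup>2 * second_moment u F))"
      using \<eta> Y0 qF by (simp add: ennreal_plus[symmetric] del: ennreal_plus)
    finally have "X + 1/2 * q\<^sup>2 * second_moment u F - correlation u u \<gamma>' \<le> Y + (\<eta>/4 + \<eta>/4 + q\<^sup>2 * second_moment u F)"
      using \<eta> Y0 qF by (subst (asm) ennreal_le_iff) auto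
    moreover have "q\<^sup>2 * second_moment u F \<le> \<eta>/4" "q\<^sup>2 * second_moment u G \<le> \<eta>/4"
      using mult_left_mono[OF C(1), of "q\<^sup>2"] mult_left_mono[OF C(2), of "q\<^sup>2"] qC by auto
    \<comment> \<open>The errors are \<open>\<eta> / 4\<close> from the small mass,
      \<open>\<eta> / 4\<close> from the tail of \<open>F\<^sub>0\<close>, and one half of each of
      the two moment terms just bounded: in total at most \<open>3 / 4 * \<eta>\<close>.\<close>
    ultimately have "correlation u u \<gamma> \<le> correlation u u \<gamma>' + \<eta>" using \<eta> qF by (simp add: Y_def)
    then show "\<exists>\<gamma>'\<in>couplings F\<^sub>0 F. correlation u u \<gamma> \<le> correlation u u \<gamma>' + \<eta>" using \<gamma>' by blast
  qed
qed

subsection \<open>The Wasserstein distance\<close>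

lemma wasserstein2_sq_eq:
  "wasserstein2_sq F\<^sub>0 F = (INF \<gamma>\<in>couplings F\<^sub>0 F. \<integral>\<^sup>+z. ennreal (1/2 * (norm (fst z - snd z))\<^sup>2) \<partial>\<gamma>)"
  unfolding wasserstein2_sq_def split_beta' ..

lemma wasserstein2_sq_le:
  "\<gamma> \<in> couplings F\<^sub>0 F \<Longrightarrow> wasserstein2_sq F\<^sub>0 F \<le> (\<integral>\<^sup>+z. ennreal (1/2 * (norm (fst z - snd z))\<^sup>2) \<partial>\<gamma>)"
  unfolding wasserstein2_sq_eq by (rule INF_lower)

lemma wasserstein2_sq_finite:
  assumes F: "F\<^sub>0 \<in> prob_densities" "F \<in> prob_densities"
  shows "wasserstein2_sq F\<^sub>0 F < \<infinity>"
  using wasserstein2_sq_le[OF product_coupling[OF F]]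
    transport_cost_eq(1)[OF product_coupling[OF F] F, of 1 0 1 0]
  by (simp add: order_le_less_trans)

text \<open>Finiteness makes adding \<open>e\<close> a strict increase of the infimum. Near-optimal
  couplings suffice throughout, so no optimal coupling has to be constructed.\<close>

lemma wasserstein2_sq_approx:
  fixes e :: real
  assumes F: "F\<^sub>0 \<in> prob_densities" "F \<in> prob_densities" and "e > 0"
  obtains \<gamma> where "\<gamma> \<in> couplings F\<^sub>0 F"
    "(\<integral>\<^sup>+z. ennreal (1/2 * (norm (fst z - snd z))\<^sup>2) \<partial>\<gamma>) \<le> wasserstein2_sq F\<^sub>0 F + ennreal e"
proof -
  have "wasserstein2_sq F\<^sub>0 F < wasserstein2_sq F\<^sub>0 F + ennreal e"
    using wasserstein2_sq_finite[OF F] \<open>e > 0\<close> by (cases "wasserstein2_sq F\<^sub>0 F") (auto simp: ennreal_plus[symmetric] ennreal_less_iff simp del: ennreal_plus)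
  then obtain \<gamma> where "\<gamma> \<in> couplings F\<^sub>0 F"
    "(\<integral>\<^sup>+z. ennreal (1/2 * (norm (fst z - snd z))\<^sup>2) \<partial>\<gamma>) < wasserstein2_sq F\<^sub>0 F + ennreal e"
    unfolding wasserstein2_sq_eq[of F\<^sub>0 F] INF_less_iff by blast
  then show thesis using that by (auto intro: less_imp_le)
qed

text \<open>Average two couplings that are optimal up to \<open>e / 2\<close>, and let
  \<open>e\<close> tend to 0. The doubled form avoids dividing extended values.\<close>

lemma wasserstein2_sq_midpoint:
  fixes F\<^sub>0 F G :: "'a::euclidean_space \<Rightarrow> real"
  assumes F\<^sub>0: "F\<^sub>0 \<in> prob_densities" and F: "F \<in> prob_densities" and G: "G \<in> prob_densities"
  shows "2 * wasserstein2_sq F\<^sub>0 (\<lambda>v. (F v + G v) / 2) \<le> wasserstein2_sq F\<^sub>0 F + wasserstein2_sq F\<^sub>0 G"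
proof (rule ennreal_le_epsilon)
  note [measurable] = prob_densities_measurable[OF F\<^sub>0] prob_densities_measurable[OF F] prob_densities_measurable[OF G]
  fix e :: real assume "e > 0"
  let ?c = "\<lambda>z::'a \<times> 'a. ennreal (1/2 * (norm (fst z - snd z))\<^sup>2)"
  obtain \<gamma> where \<gamma>: "\<gamma> \<in> couplings F\<^sub>0 F" "(\<integral>\<^sup>+z. ?c z \<partial>\<gamma>) \<le> wasserstein2_sq F\<^sub>0 F + ennreal (e/2)"
    using wasserstein2_sq_approx[OF F\<^sub>0 F, of "e/2"] \<open>e > 0\<close> by auto
  obtain \<gamma>' where \<gamma>': "\<gamma>' \<in> couplings F\<^sub>0 G" "(\<integral>\<^sup>+z. ?c z \<partial>\<gamma>') \<le> wasserstein2_sq F\<^sub>0 G + ennreal (e/2)"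
    using wasserstein2_sq_approx[OF F\<^sub>0 G, of "e/2"] \<open>e > 0\<close> by auto
  have s: "sets \<gamma> = sets (borel \<Otimes>\<^sub>M borel)" "sets \<gamma>' = sets (borel \<Otimes>\<^sub>M borel)"
    using \<gamma> \<gamma>' by (auto simp: couplings_def)
  have m: "measurable (add_measures \<gamma> \<gamma>') N = measurable (borel \<Otimes>\<^sub>M borel) N"
    "measurable \<gamma> N = measurable (borel \<Otimes>\<^sub>M borel) N" for N :: "ennreal measure"
    by (auto intro!: measurable_cong_sets simp: s)
  have half: "2 * ((1/2) * x) = x" for x :: ennreal
  proof -
    have "2 * (1/2) = (1::ennreal)" by (simp add: ennreal_times_divide)
    then show ?thesis by (simp add: mult.assoc[symmetric])
  qed
  have "2 * wasserstein2_sq F\<^sub>0 (\<lambda>v. (F v + G v) / 2) \<le> 2 * (\<integral>\<^sup>+z. ?c z \<partial>scale_measure (1/2) (add_measures \<gamma> \<gamma>'))"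
    using prob_densities_nonneg[OF F] prob_densities_nonneg[OF G]
    by (intro mult_left_mono wasserstein2_sq_le coupling_midpoint \<gamma> \<gamma>') auto
  also have "\<dots> = (\<integral>\<^sup>+z. ?c z \<partial>\<gamma>) + (\<integral>\<^sup>+z. ?c z \<partial>\<gamma>')"
  proof -
    have "(\<integral>\<^sup>+z. ?c z \<partial>scale_measure (1/2) (add_measures \<gamma> \<gamma>')) = (1/2) * ((\<integral>\<^sup>+z. ?c z \<partial>\<gamma>) + (\<integral>\<^sup>+z. ?c z \<partial>\<gamma>'))"
      by (simp add: m s nn_integral_scale_measure nn_integral_add_measures)
    then show ?thesis by (simp only: half)
  qed
  also have "\<dots> \<le> (wasserstein2_sq F\<^sub>0 F + ennreal (e/2)) + (wasserstein2_sq F\<^sub>0 G + ennreal (e/2))"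
    by (intro add_mono \<gamma> \<gamma>')
  also have "\<dots> = wasserstein2_sq F\<^sub>0 F + wasserstein2_sq F\<^sub>0 G + (ennreal (e/2) + ennreal (e/2))"
    by (simp only: ac_simps)
  also have "ennreal (e/2) + ennreal (e/2) = ennreal e"
    using \<open>e > 0\<close> by (simp add: ennreal_plus[symmetric] del: ennreal_plus)
  finally show "2 * wasserstein2_sq F\<^sub>0 (\<lambda>v. (F v + G v) / 2) \<le> wasserstein2_sq F\<^sub>0 F + wasserstein2_sq F\<^sub>0 G + ennreal e" .
qed

subsection \<open>Relative entropy with respect to a Gaussian\<close>

text \<open>Left unnormalised: its total mass enters the comparison with the entropy only as an
  additive constant.\<close>

definition maxwellian :: "real \<Rightarrow> 'a::euclidean_space \<Rightarrow> 'a \<Rightarrow> real" where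
  "maxwellian \<theta> u v = exp (- ((norm (v - u))\<^sup>2 / (2 * \<theta>)))"

lemma maxwellian_measurable [measurable]: "maxwellian \<theta> u \<in> borel_measurable borel"
  unfolding maxwellian_def by measurable

lemma maxwellian_nonneg [simp]: "0 \<le> maxwellian \<theta> u v"
  by (simp add: maxwellian_def)

text \<open>The exponential of a sum of squares factors over the coordinates, and each factor is a
  multiple of a one-dimensional normal density.\<close>

lemma maxwellian_integrable:
  fixes u :: "'a::euclidean_space"
  assumes "\<theta> > 0"
  shows "integrable lborel (maxwellian \<theta> u)"
proof (rule integrableI_nonneg)
  have one: "(\<integral>\<^sup>+x. ennreal (exp (- ((x - m)\<^sup>2 / (2 * \<theta>)))) \<partial>lborel) < \<infinity>" for m :: real
  proof -
    have "integrable lborel (\<lambda>x. sqrt (2 * pi * \<theta>) * normal_density m (sqrt \<theta>) x)"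
      using assms by (intro integrable_mult_right integrable_normal_density) auto
    also have "(\<lambda>x. sqrt (2 * pi * \<theta>) * normal_density m (sqrt \<theta>) x) = (\<lambda>x. exp (- ((x - m)\<^sup>2 / (2 * \<theta>))))"
      using assms by (auto simp: normal_density_def fun_eq_iff)
    finally show ?thesis by (simp add: integrable_iff_bounded)
  qed
  have "(\<integral>\<^sup>+v. ennreal (maxwellian \<theta> u v) \<partial>lborel)
      = (\<integral>\<^sup>+v. (\<Prod>b\<in>Basis. ennreal (exp (- ((v \<bullet> b - u \<bullet> b)\<^sup>2 / (2 * \<theta>))))) \<partial>lborel)"
  proof (intro nn_integral_cong)
    fix v :: 'a
    have "(norm (v - u))\<^sup>2 = (\<Sum>b\<in>Basis. (v \<bullet> b - u \<bullet> b)\<^sup>2)"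
      unfolding power2_norm_eq_inner by (subst euclidean_inner) (simp add: power2_eq_square inner_diff_left)
    then show "ennreal (maxwellian \<theta> u v) = (\<Prod>b\<in>Basis. ennreal (exp (- ((v \<bullet> b - u \<bullet> b)\<^sup>2 / (2 * \<theta>)))))"
      by (simp add: maxwellian_def prod_ennreal exp_sum[symmetric] sum_negf sum_divide_distrib)
  qed
  also have "\<dots> = (\<Prod>b\<in>(Basis :: 'a set). (\<integral>\<^sup>+x. ennreal (exp (- ((x - u \<bullet> b)\<^sup>2 / (2 * \<theta>)))) \<partial>lborel))"
    by (rule nn_integral_lborel_prod) auto
  also have "\<dots> < \<infinity>"
    using one by (simp add: ennreal_prod_eq_top less_top[symmetric])
  finally show "(\<integral>\<^sup>+v. ennreal (maxwellian \<theta> u v) \<partial>lborel) < \<infinity>" .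
qed auto

definition maxwellian_mass :: "real \<Rightarrow> 'a::euclidean_space \<Rightarrow> real" where
  "maxwellian_mass \<theta> u = (\<integral>v. maxwellian \<theta> u v \<partial>lborel)"

lemma nn_integral_maxwellian:
  "\<theta> > 0 \<Longrightarrow> (\<integral>\<^sup>+v. ennreal (maxwellian \<theta> u v) \<partial>lborel) = ennreal (maxwellian_mass \<theta> u)"
  unfolding maxwellian_mass_def
  by (rule nn_integral_eq_integral) (auto simp: maxwellian_integrable)

lemma maxwellian_mass_nonneg: "0 \<le> maxwellian_mass \<theta> u"
  unfolding maxwellian_mass_def by (rule integral_nonneg_AE) auto

text \<open>
  \<open>F ln (F / M) - F + M\<close> for the unnormalized Gaussian \<open>M\<close>. Unlike \<open>F ln F\<close> this is nonnegative,
  so that its integral is lower semicontinuous by Fatou's lemma.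
\<close>

definition relative_entropy_density :: "real \<Rightarrow> 'a::euclidean_space \<Rightarrow> real \<Rightarrow> 'a \<Rightarrow> real" where
  "relative_entropy_density \<theta> u x v =
     x * ln x + (norm (v - u))\<^sup>2 / (2 * \<theta>) * x - x + maxwellian \<theta> u v"

definition relative_entropy :: "real \<Rightarrow> 'a::euclidean_space \<Rightarrow> ('a \<Rightarrow> real) \<Rightarrow> ennreal" where
  "relative_entropy \<theta> u F = (\<integral>\<^sup>+v. ennreal (relative_entropy_density \<theta> u (F v) v) \<partial>lborel)"

text \<open>This is \<open>ln y \<le> y - 1\<close>, with \<open>y\<close> the quotient of the
  Gaussian by \<open>x\<close>, multiplied by \<open>x\<close>. At \<open>x = 0\<close> only the
  Gaussian remains.\<close>

lemma relative_entropy_density_nonneg: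
  assumes "0 \<le> x"
  shows "0 \<le> relative_entropy_density \<theta> u x v"
proof (cases "x = 0")
  case True
  then show ?thesis by (simp add: relative_entropy_density_def)
next
  case False
  then have x: "x > 0" using assms by simp
  let ?E = "(norm (v - u))\<^sup>2 / (2 * \<theta>)"
  have "ln (exp (- ?E) / x) \<le> exp (- ?E) / x - 1"
    using x by (intro ln_le_minus_one) auto
  then have "x * (- ?E - ln x) \<le> x * (exp (- ?E) / x - 1)"
    using x by (intro mult_left_mono) (auto simp: ln_div)
  then show ?thesis
    using x unfolding relative_entropy_density_def maxwellian_def by (simp add: algebra_simps)
qed

lemma relative_entropy_density_measurable [measurable]:
  assumes [measurable]: "F \<in> borel_measurable borel"
  shows "(\<lambda>v. relative_entropy_density \<theta> u (F v) v) \<in> borel_measurable borel"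
  unfolding relative_entropy_density_def by measurable

lemma nn_integral_potential:
  assumes "\<theta> > 0" and F: "F \<in> prob_densities"
  shows "(\<integral>\<^sup>+v. ennreal ((norm (v - u))\<^sup>2 * F v / (2 * \<theta>)) \<partial>lborel) = ennreal (second_moment u F / (2 * \<theta>))"
proof -
  note [measurable] = prob_densities_measurable[OF F]
  have "(\<integral>\<^sup>+v. ennreal ((norm (v - u))\<^sup>2 * F v / (2 * \<theta>)) \<partial>lborel) = (\<integral>\<^sup>+v. ennreal (1 / (2 * \<theta>)) * ennreal ((norm (v - u))\<^sup>2 * F v) \<partial>lborel)"
    using assms prob_densities_nonneg[OF F] by (intro nn_integral_cong) (simp add: ennreal_mult[symmetric])
  also have "\<dots> = ennreal (second_moment u F / (2 * \<theta>))"
    using assms second_moment_nonneg[OF F, of u]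
    by (simp add: nn_integral_cmult nn_integral_second_moment ennreal_mult[symmetric])
  finally show ?thesis .
qed

text \<open>The positive and negative parts of \<open>F ln F\<close> have to be related to one
  nonnegative integral without subtracting infinities. The pointwise identity is therefore arranged
  so that every term is nonnegative on its side, and subtraction takes place only once the negative
  part is known to be finite.\<close>

lemma entropy_functional_eq:
  fixes F :: "'a::euclidean_space \<Rightarrow> real" and \<theta> :: real
  assumes \<theta>: "\<theta> > 0" and F: "F \<in> prob_densities"
  shows "entropy_functional F
    = enn2ereal (relative_entropy \<theta> u F) + ereal (1 - second_moment u F / (2 * \<theta>) - maxwellian_mass \<theta> u)"
proof -
  note [measurable] = prob_densities_measurable[OF F]
  note nn = prob_densities_nonneg[OF F]
  let ?E = "\<lambda>v. (norm (v - u))\<^sup>2 / (2 * \<theta>)"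
  define P where "P = (\<integral>\<^sup>+v. ennreal (F v * ln (F v)) \<partial>lborel)"
  define N where "N = (\<integral>\<^sup>+v. ennreal (- (F v * ln (F v))) \<partial>lborel)"
  define s where "s = second_moment u F / (2 * \<theta>)"
  have s0: "0 \<le> s" using \<theta> second_moment_nonneg[OF F, of u] by (simp add: s_def)
  have "(\<integral>\<^sup>+v. ennreal (relative_entropy_density \<theta> u (F v) v) + ennreal (- (F v * ln (F v))) + ennreal (F v) \<partial>lborel)
    = (\<integral>\<^sup>+v. ennreal (F v * ln (F v)) + ennreal (?E v * F v) + ennreal (maxwellian \<theta> u v) \<partial>lborel)"
  proof (intro nn_integral_cong)
    fix v
    have r: "0 \<le> relative_entropy_density \<theta> u (F v) v" by (rule relative_entropy_density_nonneg) (rule nn)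
    have E: "0 \<le> ?E v * F v" using nn \<theta> by simp
    have M: "0 \<le> maxwellian \<theta> u v" by simp
    show "ennreal (relative_entropy_density \<theta> u (F v) v) + ennreal (- (F v * ln (F v))) + ennreal (F v)
      = ennreal (F v * ln (F v)) + ennreal (?E v * F v) + ennreal (maxwellian \<theta> u v)"
    proof (cases "0 \<le> F v * ln (F v)")
      case True
      then have "ennreal (- (F v * ln (F v))) = 0" by (simp add: ennreal_neg)
      then show ?thesis using True r E M nn[of v]
        by (simp add: ennreal_plus[symmetric] relative_entropy_density_def del: ennreal_plus)
    next
      case False
      then have "ennreal (F v * ln (F v)) = 0" by (simp add: ennreal_neg)
      then show ?thesis using False r E M nn[of v]
        by (simp add: ennreal_plus[symmetric] relative_entropy_density_def del: ennreal_plus)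
    qed
  qed
  then have eq: "relative_entropy \<theta> u F + N + 1 = P + ennreal s + ennreal (maxwellian_mass \<theta> u)"
    using \<theta> by (simp add: nn_integral_add relative_entropy_def[symmetric] P_def[symmetric] N_def[symmetric]
        prob_densities_nn_integral[OF F] nn_integral_potential[OF \<theta> F] nn_integral_maxwellian s_def)
  \<comment> \<open>Nonnegativity of the relative entropy density bounds the negative part of
    \<open>F ln F\<close> by the potential plus the Gaussian, both of finite integral; this excludes
    a difference of two infinities.\<close>
  have "N \<le> (\<integral>\<^sup>+v. ennreal (?E v * F v) + ennreal (maxwellian \<theta> u v) \<partial>lborel)"
    unfolding N_def
  proof (intro nn_integral_mono)
    fix v
    have "- (F v * ln (F v)) \<le> ?E v * F v + maxwellian \<theta> u v"
      using relative_entropy_density_nonneg[OF nn[of v], of \<theta> u v] nn[of v]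
      by (simp add: relative_entropy_density_def)
    then show "ennreal (- (F v * ln (F v))) \<le> ennreal (?E v * F v) + ennreal (maxwellian \<theta> u v)"
      using nn \<theta> by (simp add: ennreal_plus[symmetric] ennreal_leI del: ennreal_plus)
  qed
  also have "\<dots> < \<infinity>"
    using \<theta> by (simp add: nn_integral_add nn_integral_potential[OF \<theta> F] nn_integral_maxwellian)
  finally obtain n where n: "N = ennreal n" "n \<ge> 0" by (cases N) auto
  note Z = maxwellian_mass_nonneg[of \<theta> u]
  have "entropy_functional F = enn2ereal P - enn2ereal N"
    by (simp add: entropy_functional_def P_def N_def)
  also have "\<dots> = enn2ereal (relative_entropy \<theta> u F) + ereal (1 - s - maxwellian_mass \<theta> u)"
  proof (cases P)
    case (real p)
    then obtain k where k: "relative_entropy \<theta> u F = ennreal k" "k \<ge> 0"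
      using eq n Z s0 by (cases "relative_entropy \<theta> u F") (auto simp flip: ennreal_plus)
    have "ennreal (k + n + 1) = ennreal (p + s + maxwellian_mass \<theta> u)"
      using eq k n Z s0 real by (simp add: ennreal_plus)
    then have "k + n + 1 = p + s + maxwellian_mass \<theta> u" using k n Z s0 real by (subst (asm) ennreal_inj) auto
    then show ?thesis using k n real by (simp add: enn2ereal_ennreal)
  next
    case top
    then have "relative_entropy \<theta> u F = top" using eq n by (auto simp: ennreal_add_eq_top)
    then show ?thesis using top n by (simp add: enn2ereal_ennreal)
  qed
  finally show ?thesis by (simp add: s_def)
qed

subsection \<open>Affine rescaling\<close>

lemma nn_integral_lborel_affine:
  fixes t :: "'a::euclidean_space"
  assumes "c > 0" and [measurable]: "f \<in> borel_measurable borel"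
  shows "(\<integral>\<^sup>+x. f x \<partial>lborel) = (\<integral>\<^sup>+y. ennreal (c ^ DIM('a)) * f (t + c *\<^sub>R y) \<partial>lborel)"
  using \<open>c > 0\<close>
  by (subst lborel_affine[of c t]) (simp_all add: nn_integral_density nn_integral_distr)

lemma integral_lborel_affine:
  fixes t :: "'a::euclidean_space" and f :: "'a \<Rightarrow> 'b::{banach, second_countable_topology}"
  assumes "c > 0" and [measurable]: "f \<in> borel_measurable borel"
  shows "(\<integral>x. f x \<partial>lborel) = (\<integral>y. (c ^ DIM('a)) *\<^sub>R f (t + c *\<^sub>R y) \<partial>lborel)"
  using \<open>c > 0\<close>
  by (subst lborel_affine[of c t]) (simp_all add: integral_density integral_distr)

text \<open>The density of \<open>u + c (V - m)\<close> when \<open>V\<close> has density \<open>F\<close>.\<close>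

definition rescale :: "'a::euclidean_space \<Rightarrow> real \<Rightarrow> 'a \<Rightarrow> ('a \<Rightarrow> real) \<Rightarrow> 'a \<Rightarrow> real" where
  "rescale m c u F x = F (m + (1 / c) *\<^sub>R (x - u)) / c ^ DIM('a)"

lemma rescale_measurable [measurable (raw)]:
  assumes [measurable]: "F \<in> borel_measurable borel"
  shows "rescale m c u F \<in> borel_measurable borel"
  unfolding rescale_def by measurable

lemma rescale_at:
  fixes F :: "'a::euclidean_space \<Rightarrow> real"
  shows "c > 0 \<Longrightarrow> rescale m c u F (u - c *\<^sub>R m + c *\<^sub>R y) = F y / c ^ DIM('a)"
  by (simp add: rescale_def scaleR_diff_right scaleR_add_right algebra_simps)

lemma nn_integral_rescale:
  fixes F :: "'a::euclidean_space \<Rightarrow> real"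
  assumes "c > 0" and [measurable]: "F \<in> borel_measurable borel" "g \<in> borel_measurable borel" and nn: "\<And>v. 0 \<le> F v"
  shows "(\<integral>\<^sup>+x. ennreal (rescale m c u F x) * g x \<partial>lborel) = (\<integral>\<^sup>+y. ennreal (F y) * g (u + c *\<^sub>R (y - m)) \<partial>lborel)"
proof -
  have "(\<integral>\<^sup>+x. ennreal (rescale m c u F x) * g x \<partial>lborel)
    = (\<integral>\<^sup>+y. ennreal (c ^ DIM('a)) * (ennreal (F y / c ^ DIM('a)) * g (u - c *\<^sub>R m + c *\<^sub>R y)) \<partial>lborel)"
    using \<open>c > 0\<close> by (subst nn_integral_lborel_affine[of c _ "u - c *\<^sub>R m"]) (simp_all add: rescale_at)
  also have "\<dots> = (\<integral>\<^sup>+y. ennreal (F y) * g (u + c *\<^sub>R (y - m)) \<partial>lborel)"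
    using \<open>c > 0\<close> nn
    by (intro nn_integral_cong) (simp add: mult.assoc[symmetric] ennreal_mult[symmetric] scaleR_diff_right algebra_simps)
  finally show ?thesis .
qed

lemma rescale_in_fixed_moment_densities:
  fixes F :: "'a::euclidean_space \<Rightarrow> real" and \<theta> :: real
  assumes F: "F \<in> prob_densities" and m: "(\<integral>v. F v *\<^sub>R v \<partial>lborel) = m"
    and c: "c > 0" "c\<^sup>2 * second_moment m F = DIM('a) * \<theta>"
  shows "rescale m c u F \<in> fixed_moment_densities u \<theta>"
proof -
  note [measurable] = prob_densities_measurable[OF F]
  note nn = prob_densities_nonneg[OF F]
  have nn': "0 \<le> rescale m c u F v" for v using nn c by (simp add: rescale_def)
  have one: "(\<integral>\<^sup>+v. ennreal (rescale m c u F v) \<partial>lborel) = 1"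
    using nn_integral_rescale[of c F "\<lambda>_. 1" m u] c nn by (simp add: prob_densities_nn_integral[OF F])
  have "(\<integral>\<^sup>+v. ennreal ((norm (v - u))\<^sup>2 * rescale m c u F v) \<partial>lborel)
    = (\<integral>\<^sup>+v. ennreal (rescale m c u F v) * ennreal ((norm (v - u))\<^sup>2) \<partial>lborel)"
    using nn' by (intro nn_integral_cong) (simp add: ennreal_mult[symmetric] mult.commute)
  also have "\<dots> = (\<integral>\<^sup>+y. ennreal (F y) * ennreal ((norm (c *\<^sub>R (y - m)))\<^sup>2) \<partial>lborel)"
    by (subst nn_integral_rescale) (simp_all add: c nn)
  also have "\<dots> = (\<integral>\<^sup>+y. ennreal (c\<^sup>2) * ennreal ((norm (y - m))\<^sup>2 * F y) \<partial>lborel)"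
    using nn c by (intro nn_integral_cong) (simp add: ennreal_mult[symmetric] power_mult_distrib mult_ac)
  also have "\<dots> = ennreal (DIM('a) * \<theta>)"
    by (simp add: nn_integral_cmult nn_integral_second_moment[OF F] ennreal_mult[symmetric] second_moment_nonneg[OF F] c)
  finally have sm: "(\<integral>\<^sup>+v. ennreal ((norm (v - u))\<^sup>2 * rescale m c u F v) \<partial>lborel) = ennreal (DIM('a) * \<theta>)" .
  have P: "rescale m c u F \<in> prob_densities"
    by (rule prob_densitiesI[where c=u]) (simp_all add: nn' one sm)
  have "0 \<le> DIM('a) * \<theta>" unfolding c(2)[symmetric] using second_moment_nonneg[OF F] by simp
  then have "second_moment u (rescale m c u F) = DIM('a) * \<theta>"
    using nn_integral_second_moment[OF P, of u] second_moment_nonneg[OF P, of u] unfolding sm by simp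
  moreover have "(\<integral>v. rescale m c u F v *\<^sub>R v \<partial>lborel) = u"
  proof -
    have "(\<integral>v. rescale m c u F v *\<^sub>R v \<partial>lborel) = (\<integral>y. c ^ DIM('a) *\<^sub>R (F y / c ^ DIM('a)) *\<^sub>R (u - c *\<^sub>R m + c *\<^sub>R y) \<partial>lborel)"
      using c by (subst integral_lborel_affine[of c _ "u - c *\<^sub>R m"]) (simp_all add: rescale_at)
    also have "\<dots> = (\<integral>y. F y *\<^sub>R u + c *\<^sub>R (F y *\<^sub>R (y - m)) \<partial>lborel)"
      using c by (intro Bochner_Integration.integral_cong refl) (simp add: algebra_simps)
    also have "\<dots> = u"
      using prob_densities_integrable(1,2)[OF F] integral_centered[OF F m, of m] by (simp del: scaleR_scaleR)
    finally show ?thesis .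
  qed
  ultimately show ?thesis using P by (simp add: fixed_moment_densities_iff)
qed

lemma rescale_coupling:
  fixes F\<^sub>0 F :: "'a::euclidean_space \<Rightarrow> real"
  assumes \<gamma>: "\<gamma> \<in> couplings F\<^sub>0 F" and F: "F\<^sub>0 \<in> prob_densities" "F \<in> prob_densities" and "c > 0"
  shows "distr \<gamma> (borel \<Otimes>\<^sub>M borel) (\<lambda>z. (fst z, u + c *\<^sub>R (snd z - m))) \<in> couplings F\<^sub>0 (rescale m c u F)"
    (is "distr \<gamma> _ ?T \<in> _")
proof -
  note [measurable] = F[THEN prob_densities_measurable]
  have T: "?T \<in> measurable \<gamma> (borel \<Otimes>\<^sub>M borel)"
    by (simp add: coupling_measurable[OF \<gamma>])
  show ?thesis
  proof (rule couplingI)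
    fix A :: "'a set" assume [measurable]: "A \<in> sets borel"
    show "(\<integral>\<^sup>+z. indicator A (fst z) \<partial>distr \<gamma> (borel \<Otimes>\<^sub>M borel) ?T) = (\<integral>\<^sup>+v. ennreal (F\<^sub>0 v) * indicator A v \<partial>lborel)"
      by (subst nn_integral_distr[OF T]) (simp_all add: nn_integral_coupling_fst[OF \<gamma>])
    have "(\<integral>\<^sup>+z. indicator A (snd z) \<partial>distr \<gamma> (borel \<Otimes>\<^sub>M borel) ?T) = (\<integral>\<^sup>+z. indicator A (u + c *\<^sub>R (snd z - m)) \<partial>\<gamma>)"
      by (subst nn_integral_distr[OF T]) simp_all
    also have "\<dots> = (\<integral>\<^sup>+w. ennreal (F w) * indicator A (u + c *\<^sub>R (w - m)) \<partial>lborel)"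
      by (rule nn_integral_coupling_snd[OF \<gamma>]) simp_all
    also have "\<dots> = (\<integral>\<^sup>+v. ennreal (rescale m c u F v) * indicator A v \<partial>lborel)"
      using \<open>c > 0\<close> by (subst nn_integral_rescale) (simp_all add: prob_densities_nonneg[OF F(2)])
    finally show "(\<integral>\<^sup>+z. indicator A (snd z) \<partial>distr \<gamma> (borel \<Otimes>\<^sub>M borel) ?T) = (\<integral>\<^sup>+v. ennreal (rescale m c u F v) * indicator A v \<partial>lborel)" .
  qed simp_all
qed

text \<open>Dilation subtracts \<open>d * ln c\<close> from the integral of \<open>F ln F\<close>
  and replaces the potential term \<open>second_moment u F / (2 * \<theta>)\<close> by
  \<open>d / 2\<close>. Since \<open>ln c\<close> may have either sign, \<open>d * ln c\<close> is
  written as a difference \<open>a - b\<close> of nonnegative numbers, one for each side of the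
  equation.\<close>

lemma relative_entropy_rescale:
  fixes F :: "'a::euclidean_space \<Rightarrow> real" and \<theta> :: real
  assumes \<theta>: "\<theta> > 0" and F: "F \<in> prob_densities"
    and c: "c > 0" "c\<^sup>2 * second_moment m F = DIM('a) * \<theta>"
    and ab: "0 \<le> a" "0 \<le> b" "a - b = DIM('a) * ln c"
  shows "relative_entropy \<theta> u (rescale m c u F) + ennreal (maxwellian_mass \<theta> u + second_moment u F / (2 * \<theta>) + a)
    = relative_entropy \<theta> u F + ennreal (maxwellian_mass \<theta> u + DIM('a) / 2 + b)"
proof -
  note [measurable] = prob_densities_measurable[OF F]
  note nn = prob_densities_nonneg[OF F]
  let ?d = "DIM('a)"
  let ?T = "\<lambda>y. u - c *\<^sub>R m + c *\<^sub>R y"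
  let ?E = "\<lambda>v. (norm (v - u))\<^sup>2 / (2 * \<theta>)"
  let ?r = "relative_entropy_density \<theta> u"
  note Z = maxwellian_mass_nonneg[of \<theta> u]
  \<comment> \<open>The integrand at the image point \<open>?T y\<close>, times the Jacobian
    \<open>c ^ ?d\<close>, with negative terms carried to the opposite side. The Gaussian occurs
    both at \<open>y\<close> and, with the Jacobian, at \<open>?T y\<close>; the two integrals
    agree.\<close>
  have ptw: "c ^ ?d * ?r (F y / c ^ ?d) (?T y) + maxwellian \<theta> u y + ?E y * F y + a * F y
    = ?r (F y) y + (c\<^sup>2 / (2 * \<theta>)) * ((norm (y - m))\<^sup>2 * F y) + c ^ ?d * maxwellian \<theta> u (?T y) + b * F y" for y
  proof -
    have n: "(norm (?T y - u))\<^sup>2 = c\<^sup>2 * (norm (y - m))\<^sup>2"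
    proof -
      have "?T y - u = c *\<^sub>R (y - m)" by (simp add: algebra_simps)
      then show ?thesis using c by (simp add: power_mult_distrib)
    qed
    have l: "F y * ln (F y / c ^ ?d) = F y * ln (F y) - (a - b) * F y"
      using nn[of y] c ab(3) by (cases "F y = 0") (auto simp: ln_div ln_realpow algebra_simps)
    have "c ^ ?d * ?r (F y / c ^ ?d) (?T y) = F y * ln (F y / c ^ ?d) + c\<^sup>2 * (norm (y - m))\<^sup>2 / (2 * \<theta>) * F y - F y + c ^ ?d * maxwellian \<theta> u (?T y)"
      unfolding relative_entropy_density_def n using c by (simp add: field_simps)
    then show ?thesis unfolding l relative_entropy_density_def by (simp add: algebra_simps)
  qed
  have "(\<integral>\<^sup>+y. ennreal (c ^ ?d) * ennreal (?r (rescale m c u F (?T y)) (?T y)) + ennreal (maxwellian \<theta> u y) + ennreal (?E y * F y) + ennreal a * ennreal (F y) \<partial>lborel)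
    = (\<integral>\<^sup>+y. ennreal (?r (F y) y) + ennreal (c\<^sup>2 / (2 * \<theta>)) * ennreal ((norm (y - m))\<^sup>2 * F y) + ennreal (c ^ ?d) * ennreal (maxwellian \<theta> u (?T y)) + ennreal b * ennreal (F y) \<partial>lborel)"
  proof (intro nn_integral_cong)
    fix y
    have "0 \<le> ?r (F y / c ^ ?d) (?T y)" "0 \<le> ?r (F y) y"
      using nn[of y] c by (auto intro!: relative_entropy_density_nonneg)
    moreover have "0 \<le> ?E y * F y" "0 \<le> (norm (y - m))\<^sup>2 * F y" "0 \<le> c\<^sup>2 / (2 * \<theta>)"
      "0 \<le> c\<^sup>2 * ((norm (y - m))\<^sup>2 * F y) / (2 * \<theta>)" using nn \<theta> by auto
    ultimately show "ennreal (c ^ ?d) * ennreal (?r (rescale m c u F (?T y)) (?T y)) + ennreal (maxwellian \<theta> u y) + ennreal (?E y * F y) + ennreal a * ennreal (F y)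
      = ennreal (?r (F y) y) + ennreal (c\<^sup>2 / (2 * \<theta>)) * ennreal ((norm (y - m))\<^sup>2 * F y) + ennreal (c ^ ?d) * ennreal (maxwellian \<theta> u (?T y)) + ennreal b * ennreal (F y)"
      using c(1) ab nn[of y] ptw[of y]
      by (simp add: rescale_at ennreal_mult[symmetric] ennreal_plus[symmetric] del: ennreal_plus)
  qed
  moreover have "(\<integral>\<^sup>+y. ennreal (c ^ ?d) * ennreal (?r (rescale m c u F (?T y)) (?T y)) \<partial>lborel) = relative_entropy \<theta> u (rescale m c u F)"
    unfolding relative_entropy_def using c by (subst nn_integral_lborel_affine[of c _ "u - c *\<^sub>R m"]) simp_all
  moreover have "(\<integral>\<^sup>+y. ennreal (c ^ ?d) * ennreal (maxwellian \<theta> u (?T y)) \<partial>lborel) = ennreal (maxwellian_mass \<theta> u)"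
    unfolding nn_integral_maxwellian[OF \<theta>, symmetric] using c by (subst nn_integral_lborel_affine[of c _ "u - c *\<^sub>R m"]) simp_all
  moreover have "ennreal (c\<^sup>2 / (2 * \<theta>)) * ennreal (second_moment m F) = ennreal (?d / 2)"
    using c(2) \<theta> second_moment_nonneg[OF F, of m] by (simp add: ennreal_mult[symmetric])
  ultimately have "relative_entropy \<theta> u (rescale m c u F) + ennreal (maxwellian_mass \<theta> u) + ennreal (second_moment u F / (2 * \<theta>)) + ennreal a
    = relative_entropy \<theta> u F + ennreal (?d / 2) + ennreal (maxwellian_mass \<theta> u) + ennreal b"
    by (simp add: nn_integral_add nn_integral_cmult nn_integral_potential[OF \<theta> F] nn_integral_maxwellian[OF \<theta>]
        nn_integral_second_moment[OF F] relative_entropy_def[symmetric] prob_densities_nn_integral[OF F])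
  then show ?thesis
    using Z ab \<theta> second_moment_nonneg[OF F, of u] by (simp add: add_ac)
qed

subsection \<open>Strict convexity\<close>

text \<open>\<open>ln y \<le> y - 1\<close> is applied to \<open>sqrt m / sqrt x\<close>. Applied to
  \<open>m / x\<close> it would give only nonnegativity; the halved logarithm gains the full square
  of the difference of the roots.\<close>

lemma entropy_ge_hellinger:
  fixes x m :: real
  assumes "0 \<le> x" "0 < m"
  shows "(sqrt x - sqrt m)\<^sup>2 \<le> x * ln x - x * ln m - x + m"
proof (cases "x = 0")
  case False
  then have x: "x > 0" using assms by simp
  have "ln (sqrt m / sqrt x) \<le> sqrt m / sqrt x - 1"
    using x assms by (intro ln_le_minus_one) auto
  then have "(ln m - ln x) / 2 \<le> sqrt m / sqrt x - 1"
    using x assms by (simp add: ln_div ln_sqrt diff_divide_distrib)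
  then have "x * ((ln m - ln x) / 2) \<le> x * (sqrt m / sqrt x - 1)"
    using x by (intro mult_left_mono) auto
  also have "\<dots> = sqrt x * sqrt m - x"
    using x by (simp add: field_simps real_div_sqrt)
  finally show ?thesis using x assms by (simp add: power2_diff field_simps)
qed (use assms in simp)

text \<open>Add \<open>entropy_ge_hellinger\<close> at \<open>x\<close> and at \<open>y\<close>,
  with \<open>m\<close> their midpoint; the linear terms cancel. The constant 1/2 comes from
  bounding the square of \<open>a - b\<close> by twice the sum of the squares of
  \<open>a - c\<close> and \<open>b - c\<close>.\<close>

lemma entropy_midpoint:
  fixes x y :: real
  assumes "0 \<le> x" "0 \<le> y"
  shows "(x + y) * ln ((x + y) / 2) + 1/2 * (sqrt x - sqrt y)\<^sup>2 \<le> x * ln x + y * ln y"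
proof (cases "x + y = 0")
  case True
  then have "x = 0" "y = 0" using assms by auto
  then show ?thesis by simp
next
  case False
  define m where "m = (x + y) / 2"
  have m: "m > 0" using False assms by (simp add: m_def)
  have "(sqrt x - sqrt y)\<^sup>2 \<le> 2 * (sqrt x - sqrt m)\<^sup>2 + 2 * (sqrt y - sqrt m)\<^sup>2"
  proof -
    have "(a - b)\<^sup>2 \<le> 2 * (a - c)\<^sup>2 + 2 * (b - c)\<^sup>2" for a b c :: real
      using zero_le_power2[of "a + b - 2 * c"] by (simp add: power2_eq_square algebra_simps)
    then show ?thesis .
  qed
  then show ?thesis
    using entropy_ge_hellinger[OF assms(1) m] entropy_ge_hellinger[OF assms(2) m]
    unfolding m_def[symmetric] by (simp add: m_def field_simps)
qed

text \<open>The squared Hellinger distance without the customary factor 1/2.\<close>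

definition hellinger_sq :: "('a::euclidean_space \<Rightarrow> real) \<Rightarrow> ('a \<Rightarrow> real) \<Rightarrow> ennreal" where
  "hellinger_sq F G = (\<integral>\<^sup>+v. ennreal ((sqrt (F v) - sqrt (G v))\<^sup>2) \<partial>lborel)"

text \<open>Apart from \<open>x * ln x\<close> the density is affine in \<open>x\<close>, so its
  midpoint gap is that of \<open>x * ln x\<close>. The factors 4 and 2 clear denominators and keep
  the estimate additive in \<open>ennreal\<close>.\<close>

lemma relative_entropy_midpoint:
  fixes F G :: "'a::euclidean_space \<Rightarrow> real"
  assumes F: "F \<in> prob_densities" and G: "G \<in> prob_densities"
  shows "4 * relative_entropy \<theta> u (\<lambda>v. (F v + G v) / 2) + hellinger_sq F G
    \<le> 2 * (relative_entropy \<theta> u F + relative_entropy \<theta> u G)"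
proof -
  note [measurable] = prob_densities_measurable[OF F] prob_densities_measurable[OF G]
  have "(\<integral>\<^sup>+v. 4 * ennreal (relative_entropy_density \<theta> u ((F v + G v) / 2) v) + ennreal ((sqrt (F v) - sqrt (G v))\<^sup>2) \<partial>lborel)
    \<le> (\<integral>\<^sup>+v. 2 * (ennreal (relative_entropy_density \<theta> u (F v) v) + ennreal (relative_entropy_density \<theta> u (G v) v)) \<partial>lborel)"
  proof (intro nn_integral_mono)
    fix v
    note nn = prob_densities_nonneg[OF F, of v] prob_densities_nonneg[OF G, of v]
    have "4 * relative_entropy_density \<theta> u ((F v + G v) / 2) v + (sqrt (F v) - sqrt (G v))\<^sup>2
      \<le> 2 * (relative_entropy_density \<theta> u (F v) v + relative_entropy_density \<theta> u (G v) v)"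
      using entropy_midpoint[OF nn] unfolding relative_entropy_density_def by (simp add: algebra_simps add_divide_distrib)
    then have "ennreal (4 * relative_entropy_density \<theta> u ((F v + G v) / 2) v + (sqrt (F v) - sqrt (G v))\<^sup>2)
      \<le> ennreal (2 * (relative_entropy_density \<theta> u (F v) v + relative_entropy_density \<theta> u (G v) v))"
      by (rule ennreal_leI)
    then show "4 * ennreal (relative_entropy_density \<theta> u ((F v + G v) / 2) v) + ennreal ((sqrt (F v) - sqrt (G v))\<^sup>2)
      \<le> 2 * (ennreal (relative_entropy_density \<theta> u (F v) v) + ennreal (relative_entropy_density \<theta> u (G v) v))"
      using nn relative_entropy_density_nonneg[of "(F v + G v) / 2" \<theta> u v]
        relative_entropy_density_nonneg[of "F v" \<theta> u v] relative_entropy_density_nonneg[of "G v" \<theta> u v]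
      by (simp add: ennreal_plus ennreal_mult)
  qed
  then show ?thesis
    by (simp add: nn_integral_add nn_integral_cmult relative_entropy_def hellinger_sq_def)
qed

text \<open>With \<open>x\<close>, \<open>y\<close> the square roots of the densities, the
  difference factors as \<open>(x - y) * (x + y)\<close> and is split by Young's inequality with
  weight \<open>K\<close>. The square of \<open>x + y\<close> is at most
  \<open>2 * (x\<^sup>2 + y\<^sup>2)\<close>, which integrates to 4; this gives
  \<open>2 / K\<close>. Optimising over \<open>K\<close> is left to the application.\<close>

lemma L1_le_hellinger_sq:
  fixes F G :: "'a::euclidean_space \<Rightarrow> real"
  assumes F: "F \<in> prob_densities" and G: "G \<in> prob_densities" and "K > 0"
  shows "(\<integral>\<^sup>+v. ennreal \<bar>F v - G v\<bar> \<partial>lborel) \<le> ennreal (K/2) * hellinger_sq F G + ennreal (2/K)"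
proof -
  note [measurable] = prob_densities_measurable[OF F] prob_densities_measurable[OF G]
  have "(\<integral>\<^sup>+v. ennreal \<bar>F v - G v\<bar> \<partial>lborel)
    \<le> (\<integral>\<^sup>+v. ennreal (K/2) * ennreal ((sqrt (F v) - sqrt (G v))\<^sup>2) + ennreal (1/K) * (ennreal (F v) + ennreal (G v)) \<partial>lborel)"
  proof (intro nn_integral_mono)
    fix v
    note nn = prob_densities_nonneg[OF F, of v] prob_densities_nonneg[OF G, of v]
    define x y where "x = sqrt (F v)" and "y = sqrt (G v)"
    have xy: "F v = x\<^sup>2" "G v = y\<^sup>2" "0 \<le> x" "0 \<le> y" using nn by (auto simp: x_def y_def)
    have "\<bar>x\<^sup>2 - y\<^sup>2\<bar> = \<bar>x - y\<bar> * (x + y)"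
      using xy by (simp add: power2_eq_square square_diff_square_factored abs_mult)
    also have "\<dots> \<le> K/2 * (x - y)\<^sup>2 + (x + y)\<^sup>2 / (2 * K)"
    proof -
      have "0 \<le> (K * \<bar>x - y\<bar> - (x + y))\<^sup>2 / (2 * K)" using \<open>K > 0\<close> by simp
      also have "\<dots> = K/2 * \<bar>x - y\<bar>\<^sup>2 + (x + y)\<^sup>2 / (2 * K) - \<bar>x - y\<bar> * (x + y)"
        unfolding power2_diff using \<open>K > 0\<close> by (simp add: field_simps power2_eq_square)
      finally show ?thesis by simp
    qed
    also have "(x + y)\<^sup>2 / (2 * K) \<le> (2 * (x\<^sup>2 + y\<^sup>2)) / (2 * K)"
      using \<open>K > 0\<close> sum_squares_bound[of x y] by (intro divide_right_mono) (auto simp: power2_sum)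
    finally have "\<bar>F v - G v\<bar> \<le> K/2 * (sqrt (F v) - sqrt (G v))\<^sup>2 + 1/K * (F v + G v)"
      using \<open>K > 0\<close> by (simp add: xy x_def[symmetric] y_def[symmetric] field_simps)
    then have "ennreal \<bar>F v - G v\<bar> \<le> ennreal (K/2 * (sqrt (F v) - sqrt (G v))\<^sup>2 + 1/K * (F v + G v))"
      by (rule ennreal_leI)
    then show "ennreal \<bar>F v - G v\<bar> \<le> ennreal (K/2) * ennreal ((sqrt (F v) - sqrt (G v))\<^sup>2) + ennreal (1/K) * (ennreal (F v) + ennreal (G v))"
      using nn \<open>K > 0\<close> by (simp add: ennreal_mult[symmetric] ennreal_plus[symmetric] del: ennreal_plus)
  qed
  also have "\<dots> = ennreal (K/2) * hellinger_sq F G + ennreal (1/K) * 2"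
    by (simp add: nn_integral_add nn_integral_cmult hellinger_sq_def prob_densities_nn_integral[OF F] prob_densities_nn_integral[OF G])
  also have "ennreal (1/K) * 2 = ennreal (2/K)"
    using \<open>K > 0\<close> by (simp flip: ennreal_numeral ennreal_mult)
  finally show ?thesis .
qed

section \<open>Convexity of the admissible class and of the functional\<close>

lemma fixed_moment_densities_midpoint:
  fixes F G :: "'a::euclidean_space \<Rightarrow> real" and \<theta> :: real
  assumes F: "F \<in> fixed_moment_densities u \<theta>" and G: "G \<in> fixed_moment_densities u \<theta>"
  shows "(\<lambda>v. (F v + G v) / 2) \<in> fixed_moment_densities u \<theta>"
proof -
  have F': "F \<in> prob_densities" "second_moment u F = DIM('a) * \<theta>" "(\<integral>v. F v *\<^sub>R v \<partial>lborel) = u"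
    and G': "G \<in> prob_densities" "second_moment u G = DIM('a) * \<theta>" "(\<integral>v. G v *\<^sub>R v \<partial>lborel) = u"
    using F G by (auto simp: fixed_moment_densities_iff)
  note [measurable] = prob_densities_measurable[OF F'(1)] prob_densities_measurable[OF G'(1)]
  note nn = prob_densities_nonneg[OF F'(1)] prob_densities_nonneg[OF G'(1)]
  have lin: "2 * (\<integral>\<^sup>+v. ennreal (g v * ((F v + G v) / 2)) \<partial>lborel)
      = (\<integral>\<^sup>+v. ennreal (g v * F v) \<partial>lborel) + (\<integral>\<^sup>+v. ennreal (g v * G v) \<partial>lborel)"
    if [measurable]: "g \<in> borel_measurable borel" and g: "\<And>v. 0 \<le> g v" for g :: "'a \<Rightarrow> real"
  proof -
    have "2 * (\<integral>\<^sup>+v. ennreal (g v * ((F v + G v) / 2)) \<partial>lborel)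
        = (\<integral>\<^sup>+v. ennreal 2 * ennreal (g v * ((F v + G v) / 2)) \<partial>lborel)"
      by (simp add: nn_integral_cmult)
    also have "\<dots> = (\<integral>\<^sup>+v. ennreal (g v * F v) + ennreal (g v * G v) \<partial>lborel)"
      using nn g by (intro nn_integral_cong)
        (simp add: ennreal_mult[symmetric] ennreal_plus[symmetric] distrib_left del: ennreal_plus ennreal_numeral)
    finally show ?thesis by (simp add: nn_integral_add)
  qed
  have half: "x = y" if "2 * x = y + y" for x y :: ennreal
    using that by (simp add: mult_2[symmetric] ennreal_mult_cancel_left)
  have sm: "(\<integral>\<^sup>+v. ennreal ((norm (v - u))\<^sup>2 * ((F v + G v) / 2)) \<partial>lborel) = ennreal (DIM('a) * \<theta>)"
    by (rule half, subst lin) (simp_all add: nn_integral_second_moment F' G')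
  have P: "(\<lambda>v. (F v + G v) / 2) \<in> prob_densities"
  proof (rule prob_densitiesI[where c=u])
    show "(\<integral>\<^sup>+v. ennreal ((F v + G v) / 2) \<partial>lborel) = 1"
      using lin[of "\<lambda>_. 1"] half[of "\<integral>\<^sup>+v. ennreal ((F v + G v) / 2) \<partial>lborel" 1]
      by (simp add: prob_densities_nn_integral[OF F'(1)] prob_densities_nn_integral[OF G'(1)])
  qed (use nn sm in auto)
  have "second_moment u (\<lambda>v. (F v + G v) / 2) = DIM('a) * \<theta>"
    using nn_integral_second_moment[OF P, of u] second_moment_nonneg[OF P, of u] second_moment_nonneg[OF F'(1), of u]
    unfolding sm by (simp add: F')
  moreover have "(\<integral>v. ((F v + G v) / 2) *\<^sub>R v \<partial>lborel) = u"
  proof -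
    have "(\<integral>v. ((F v + G v) / 2) *\<^sub>R v \<partial>lborel) = (\<integral>v. (1/2) *\<^sub>R (F v *\<^sub>R v) + (1/2) *\<^sub>R (G v *\<^sub>R v) \<partial>lborel)"
      by (intro Bochner_Integration.integral_cong refl) (simp add: add_divide_distrib scaleR_add_left)
    also have "\<dots> = (1/2) *\<^sub>R u + (1/2) *\<^sub>R u"
      using prob_densities_integrable(4)[OF F'(1)] prob_densities_integrable(4)[OF G'(1)] F' G' by (simp del: scaleR_scaleR scaleR_half_double)
    finally show ?thesis by (simp add: scaleR_add_left[symmetric])
  qed
  ultimately show ?thesis using P by (simp add: fixed_moment_densities_iff)
qed

text \<open>
  On \<open>fixed_moment_densities u \<theta>\<close> this differs from the functional to be minimized by a constant, but it
  takes values in \<open>[0, \<infinity>]\<close>.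
\<close>

definition shifted_functional :: "real \<Rightarrow> real \<Rightarrow> 'a::euclidean_space \<Rightarrow> ('a \<Rightarrow> real) \<Rightarrow> ('a \<Rightarrow> real) \<Rightarrow> ennreal" where
  "shifted_functional \<theta> h u F\<^sub>0 F =
     ennreal (1 / \<theta>) * wasserstein2_sq F\<^sub>0 F + ennreal h * relative_entropy \<theta> u F"

text \<open>With the second moment about \<open>u\<close> fixed, the potential contributes
  \<open>d / 2\<close> for every admissible \<open>F\<close>, so the correction is constant. The
  Wasserstein term is finite, hence an infinite value can only come from the relative
  entropy.\<close>

lemma step_functional_eq:
  fixes F\<^sub>0 F :: "'a::euclidean_space \<Rightarrow> real" and \<theta> :: real
  assumes "\<theta> > 0" "h > 0" and F\<^sub>0: "F\<^sub>0 \<in> prob_densities" and F: "F \<in> fixed_moment_densities u \<theta>"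
  shows "step_functional \<theta> h F\<^sub>0 F = enn2ereal (shifted_functional \<theta> h u F\<^sub>0 F)
    + ereal (h * (1 - DIM('a) / 2 - maxwellian_mass \<theta> u))"
proof -
  have F': "F \<in> prob_densities" "second_moment u F = DIM('a) * \<theta>"
    using F by (auto simp: fixed_moment_densities_iff)
  obtain w where w: "wasserstein2_sq F\<^sub>0 F = ennreal w" "0 \<le> w"
    using wasserstein2_sq_finite[OF F\<^sub>0 F'(1)] by (cases "wasserstein2_sq F\<^sub>0 F") auto
  define k where "k = 1 - DIM('a) / 2 - maxwellian_mass \<theta> u"
  have S: "entropy_functional F = enn2ereal (relative_entropy \<theta> u F) + ereal k"
    using entropy_functional_eq[OF \<open>\<theta> > 0\<close> F'(1), of u] \<open>\<theta> > 0\<close> F'(2) by (simp add: k_def)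
  show ?thesis
    unfolding k_def[symmetric]
  proof (cases "relative_entropy \<theta> u F")
    case (real x)
    then show "step_functional \<theta> h F\<^sub>0 F = enn2ereal (shifted_functional \<theta> h u F\<^sub>0 F) + ereal (h * k)"
      using w assms(1,2) unfolding step_functional_def shifted_functional_def S
      by (simp add: enn2ereal_ennreal ennreal_mult[symmetric] ennreal_plus[symmetric] distrib_left del: ennreal_plus)
  next
    case top
    then show "step_functional \<theta> h F\<^sub>0 F = enn2ereal (shifted_functional \<theta> h u F\<^sub>0 F) + ereal (h * k)"
      using w assms(1,2) unfolding step_functional_def shifted_functional_def S
      by (simp add: enn2ereal_ennreal ennreal_mult_top)
  qed
qed

lemma shifted_functional_midpoint:
  fixes F\<^sub>0 F G :: "'a::euclidean_space \<Rightarrow> real"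
  assumes F\<^sub>0: "F\<^sub>0 \<in> prob_densities" and F: "F \<in> prob_densities" and G: "G \<in> prob_densities"
  shows "4 * shifted_functional \<theta> h u F\<^sub>0 (\<lambda>v. (F v + G v) / 2) + ennreal h * hellinger_sq F G
    \<le> 2 * (shifted_functional \<theta> h u F\<^sub>0 F + shifted_functional \<theta> h u F\<^sub>0 G)"
proof -
  let ?M = "\<lambda>v. (F v + G v) / 2"
  have "4 * wasserstein2_sq F\<^sub>0 ?M = 2 * (2 * wasserstein2_sq F\<^sub>0 ?M)" by (simp add: mult.assoc[symmetric])
  also have "\<dots> \<le> 2 * (wasserstein2_sq F\<^sub>0 F + wasserstein2_sq F\<^sub>0 G)"
    by (intro mult_left_mono wasserstein2_sq_midpoint F\<^sub>0 F G) simp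
  finally have W: "4 * wasserstein2_sq F\<^sub>0 ?M \<le> 2 * (wasserstein2_sq F\<^sub>0 F + wasserstein2_sq F\<^sub>0 G)" .
  have "4 * shifted_functional \<theta> h u F\<^sub>0 ?M + ennreal h * hellinger_sq F G
    = ennreal (1/\<theta>) * (4 * wasserstein2_sq F\<^sub>0 ?M) + ennreal h * (4 * relative_entropy \<theta> u ?M + hellinger_sq F G)"
    by (simp add: shifted_functional_def distrib_left mult_ac add_ac)
  also have "\<dots> \<le> ennreal (1/\<theta>) * (2 * (wasserstein2_sq F\<^sub>0 F + wasserstein2_sq F\<^sub>0 G))
      + ennreal h * (2 * (relative_entropy \<theta> u F + relative_entropy \<theta> u G))"
    by (intro add_mono mult_left_mono W relative_entropy_midpoint F G) auto
  also have "\<dots> = 2 * (shifted_functional \<theta> h u F\<^sub>0 F + shifted_functional \<theta> h u F\<^sub>0 G)"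
    by (simp add: shifted_functional_def distrib_left mult_ac add_ac)
  finally show ?thesis .
qed

text \<open>The midpoint is admissible, so its value is at least \<open>m\<close>, and
  \<open>4 * m\<close> cancels against the right-hand side \<open>4 * (m + e)\<close> of the
  midpoint inequality. Positive \<open>e\<close> makes minimizing sequences Cauchy;
  \<open>e = 0\<close> gives uniqueness.\<close>

lemma hellinger_sq_near_minimizers:
  fixes F\<^sub>0 F G :: "'a::euclidean_space \<Rightarrow> real" and \<theta> e m :: real
  assumes "h > 0" and F\<^sub>0: "F\<^sub>0 \<in> prob_densities"
    and F: "F \<in> fixed_moment_densities u \<theta>" and G: "G \<in> fixed_moment_densities u \<theta>"
    and low: "\<And>H. H \<in> fixed_moment_densities u \<theta> \<Longrightarrow> ennreal m \<le> shifted_functional \<theta> h u F\<^sub>0 H"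
    and up: "shifted_functional \<theta> h u F\<^sub>0 F \<le> ennreal (m + e)" "shifted_functional \<theta> h u F\<^sub>0 G \<le> ennreal (m + e)"
    and "0 \<le> m" "0 \<le> e"
  shows "hellinger_sq F G \<le> ennreal (4 * e / h)"
proof -
  have P: "F \<in> prob_densities" "G \<in> prob_densities" using F G by (auto simp: fixed_moment_densities_iff)
  have "ennreal (4 * m) + ennreal h * hellinger_sq F G
    \<le> 4 * shifted_functional \<theta> h u F\<^sub>0 (\<lambda>v. (F v + G v) / 2) + ennreal h * hellinger_sq F G"
    using mult_left_mono[OF low[OF fixed_moment_densities_midpoint[OF F G]], of 4] \<open>0 \<le> m\<close>
    by (intro add_right_mono) (simp add: ennreal_mult)
  also have "\<dots> \<le> 2 * (ennreal (m + e) + ennreal (m + e))"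
    by (rule order_trans[OF shifted_functional_midpoint[OF F\<^sub>0 P] mult_left_mono[OF add_mono[OF up]]]) simp
  also have "\<dots> = ennreal 2 * (ennreal (m + e) + ennreal (m + e))" by simp
  also have "\<dots> = ennreal (4 * m) + ennreal (4 * e)"
    using \<open>0 \<le> m\<close> \<open>0 \<le> e\<close> by (simp add: ennreal_plus[symmetric] ennreal_mult[symmetric] del: ennreal_plus ennreal_numeral)
  finally have le: "ennreal h * hellinger_sq F G \<le> ennreal (4 * e)"
    by (simp add: ennreal_add_left_cancel_le)
  have "hellinger_sq F G = ennreal (1/h) * (ennreal h * hellinger_sq F G)"
    using \<open>h > 0\<close> by (simp add: mult.assoc[symmetric] ennreal_mult[symmetric])
  also have "\<dots> \<le> ennreal (1/h) * ennreal (4 * e)" by (rule mult_left_mono[OF le]) simp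
  also have "\<dots> = ennreal (4 * e / h)" using \<open>h > 0\<close> \<open>0 \<le> e\<close> by (simp add: ennreal_mult[symmetric])
  finally show ?thesis .
qed

lemma hellinger_sq_eq_0:
  fixes F G :: "'a::euclidean_space \<Rightarrow> real"
  assumes F: "F \<in> prob_densities" and G: "G \<in> prob_densities" and "hellinger_sq F G = 0"
  shows "AE v in lborel. F v = G v"
proof -
  note [measurable] = prob_densities_measurable[OF F] prob_densities_measurable[OF G]
  have "AE v in lborel. ennreal ((sqrt (F v) - sqrt (G v))\<^sup>2) = 0"
    using assms(3) unfolding hellinger_sq_def by (subst (asm) nn_integral_0_iff_AE) auto
  then show ?thesis
    by eventually_elim (simp add: ennreal_eq_0_iff)
qed

section \<open>Dilation: a competitor of finite entropy, and the effect on entropy and cost\<close>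

lemma finite_relative_entropy_exists:
  fixes u :: "'a::euclidean_space" and \<theta> :: real
  assumes \<theta>: "\<theta> > 0"
  obtains F where "F \<in> fixed_moment_densities u \<theta>" "relative_entropy \<theta> u F < \<infinity>"
proof -
  \<comment> \<open>The uniform density on the unit cube takes only the values 0 and 1, so
    \<open>F ln F\<close> vanishes identically and only the potential and the Gaussian remain. A
    dilation then adjusts mean and variance and keeps the relative entropy finite.\<close>
  define F :: "'a \<Rightarrow> real" where "F = indicator (cbox 0 One)"
  have meas [measurable]: "F \<in> borel_measurable borel" unfolding F_def by simp
  have F: "F \<in> prob_densities"
  proof (rule prob_densitiesI[where c=0])
    show one: "(\<integral>\<^sup>+v. ennreal (F v) \<partial>lborel) = 1"
      unfolding F_def by (simp add: ennreal_indicator emeasure_lborel_cbox_eq)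
    obtain B where B: "\<And>v::'a. v \<in> cbox 0 One \<Longrightarrow> norm v \<le> B"
      using bounded_cbox[of 0 "One::'a"] by (auto simp: bounded_iff)
    have "(\<integral>\<^sup>+v. ennreal ((norm (v - 0))\<^sup>2 * F v) \<partial>lborel) \<le> (\<integral>\<^sup>+v. ennreal (B\<^sup>2) * ennreal (F v) \<partial>lborel)"
      by (intro nn_integral_mono) (auto simp: F_def split: split_indicator intro!: ennreal_leI power_mono B)
    also have "\<dots> < \<infinity>" by (simp add: nn_integral_cmult one)
    finally show "(\<integral>\<^sup>+v. ennreal ((norm (v - 0))\<^sup>2 * F v) \<partial>lborel) < \<infinity>" .
  qed (auto simp: F_def)
  define m where "m = (\<integral>v. F v *\<^sub>R v \<partial>lborel)"
  define c where "c = sqrt (DIM('a) * \<theta> / second_moment m F)"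
  note pos = second_moment_pos[OF F, of m]
  have c: "c > 0" "c\<^sup>2 * second_moment m F = DIM('a) * \<theta>"
    using pos \<theta> by (simp_all add: c_def)
  have "relative_entropy \<theta> u F \<le> (\<integral>\<^sup>+v. ennreal ((norm (v - u))\<^sup>2 * F v / (2 * \<theta>)) + ennreal (maxwellian \<theta> u v) \<partial>lborel)"
    unfolding relative_entropy_def
  proof (intro nn_integral_mono)
    fix v
    have "relative_entropy_density \<theta> u (F v) v \<le> (norm (v - u))\<^sup>2 * F v / (2 * \<theta>) + maxwellian \<theta> u v"
      by (auto simp: relative_entropy_density_def F_def split: split_indicator)
    then show "ennreal (relative_entropy_density \<theta> u (F v) v) \<le> ennreal ((norm (v - u))\<^sup>2 * F v / (2 * \<theta>)) + ennreal (maxwellian \<theta> u v)"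
      using \<theta> prob_densities_nonneg[OF F, of v]
      by (simp add: ennreal_plus[symmetric] ennreal_leI del: ennreal_plus)
  qed
  also have "\<dots> < \<infinity>"
    using \<theta> by (simp add: nn_integral_add nn_integral_potential[OF \<theta> F] nn_integral_maxwellian)
  finally have "relative_entropy \<theta> u F < \<infinity>" .
  \<comment> \<open>The sign of \<open>ln c\<close> is unknown here, so the positive and negative
    parts of \<open>d * ln c\<close> serve as the two nonnegative summands.\<close>
  moreover have "relative_entropy \<theta> u (rescale m c u F)
      + ennreal (maxwellian_mass \<theta> u + second_moment u F / (2 * \<theta>) + max 0 (DIM('a) * ln c))
    = relative_entropy \<theta> u F + ennreal (maxwellian_mass \<theta> u + DIM('a) / 2 + max 0 (- (DIM('a) * ln c)))"
    by (rule relative_entropy_rescale[OF \<theta> F c]) auto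
  ultimately have "relative_entropy \<theta> u (rescale m c u F) < \<infinity>"
    by (metis ennreal_add_eq_top ennreal_less_top infinity_ennreal_def less_top)
  then show thesis
    using that rescale_in_fixed_moment_densities[OF F m_def[symmetric] c] by blast
qed

lemma relative_entropy_rescale_le:
  fixes F :: "'a::euclidean_space \<Rightarrow> real" and \<theta> :: real
  assumes \<theta>: "\<theta> > 0" and F: "F \<in> prob_densities" and m: "(\<integral>v. F v *\<^sub>R v \<partial>lborel) = m"
    and c: "c \<ge> 1" "c\<^sup>2 * second_moment m F = DIM('a) * \<theta>"
  shows "relative_entropy \<theta> u (rescale m c u F) \<le> relative_entropy \<theta> u F"
proof -
  have c0: "c > 0" using c by simp
  \<comment> \<open>The potential term becomes \<open>d / 2\<close> while the entropy falls by
    \<open>d * ln c\<close>. As \<open>second_moment m F / (2 * \<theta>)\<close> equals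
    \<open>d / (2 * c\<^sup>2)\<close>, the claim is the logarithm inequality at
    \<open>1 / c\<^sup>2\<close>, followed by the change of centre from \<open>m\<close> to
    \<open>u\<close>.\<close>
  have "DIM('a) / 2 \<le> second_moment u F / (2 * \<theta>) + DIM('a) * ln c"
  proof -
    have "ln (1 / c\<^sup>2) \<le> 1 / c\<^sup>2 - 1" using c0 by (intro ln_le_minus_one) auto
    then have "1 - 1 / c\<^sup>2 \<le> 2 * ln c" using c0 by (simp add: ln_div ln_realpow)
    then have "DIM('a) * ((1 - 1 / c\<^sup>2) / 2) \<le> DIM('a) * ln c" by (intro mult_left_mono) auto
    moreover have "DIM('a) / c\<^sup>2 / 2 = second_moment m F / (2 * \<theta>)"
      using c(2) c0 \<theta> by (simp add: field_simps)
    moreover have "second_moment m F / (2 * \<theta>) \<le> second_moment u F / (2 * \<theta>)"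
      using second_moment_mean_le[OF F m, of u] \<theta> by (intro divide_right_mono) auto
    ultimately show ?thesis by (simp add: field_simps)
  qed
  then have "ennreal (maxwellian_mass \<theta> u + DIM('a) / 2 + 0) \<le> ennreal (maxwellian_mass \<theta> u + second_moment u F / (2 * \<theta>) + DIM('a) * ln c)"
    by (intro ennreal_leI) simp
  then have "relative_entropy \<theta> u (rescale m c u F) + ennreal (maxwellian_mass \<theta> u + second_moment u F / (2 * \<theta>) + DIM('a) * ln c)
    \<le> relative_entropy \<theta> u F + ennreal (maxwellian_mass \<theta> u + second_moment u F / (2 * \<theta>) + DIM('a) * ln c)"
    using relative_entropy_rescale[OF \<theta> F c0 c(2), of "DIM('a) * ln c" 0 u] c(1) by (simp add: add_left_mono)
  then show ?thesis by (simp add: add.commute[of _ "ennreal _"] ennreal_add_left_cancel_le)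
qed

text \<open>Pushing the second variable through the dilation turns the cost into
  \<open>d * \<theta>\<close> minus \<open>c\<close> times the correlation, which suffices for
  nonnegative correlation because \<open>c \<ge> 1\<close>. For negative correlation the independent
  coupling, of cost \<open>d * \<theta>\<close>, is already good enough.\<close>

lemma wasserstein2_sq_rescale_le:
  fixes F\<^sub>0 F :: "'a::euclidean_space \<Rightarrow> real" and \<theta> :: real
  assumes F\<^sub>0: "F\<^sub>0 \<in> fixed_moment_densities u \<theta>"
    and F: "F \<in> prob_densities" and m: "(\<integral>v. F v *\<^sub>R v \<partial>lborel) = m"
    and c: "c \<ge> 1" "c\<^sup>2 * second_moment m F = DIM('a) * \<theta>"
    and \<gamma>: "\<gamma> \<in> couplings F\<^sub>0 F"
  shows "wasserstein2_sq F\<^sub>0 (rescale m c u F) \<le> ennreal (DIM('a) * \<theta> - correlation u u \<gamma>)"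
proof -
  have P\<^sub>0: "F\<^sub>0 \<in> prob_densities" and sm\<^sub>0: "second_moment u F\<^sub>0 = DIM('a) * \<theta>" and m\<^sub>0: "(\<integral>v. F\<^sub>0 v *\<^sub>R v \<partial>lborel) = u"
    using F\<^sub>0 by (auto simp: fixed_moment_densities_iff)
  have c0: "c > 0" using c by simp
  have R: "rescale m c u F \<in> prob_densities" "second_moment u (rescale m c u F) = DIM('a) * \<theta>" "(\<integral>v. rescale m c u F v *\<^sub>R v \<partial>lborel) = u"
    using rescale_in_fixed_moment_densities[OF F m c0 c(2), of u] by (auto simp: fixed_moment_densities_iff)
  show ?thesis
  proof (cases "0 \<le> correlation u u \<gamma>")
    case True
    let ?T = "\<lambda>z. (fst z, u + c *\<^sub>R (snd z - m))"
    have T: "?T \<in> measurable \<gamma> (borel \<Otimes>\<^sub>M borel)" by (simp add: coupling_measurable[OF \<gamma>])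
    have eq: "fst z - (u + c *\<^sub>R (snd z - m)) = 1 *\<^sub>R (fst z - u) - c *\<^sub>R (snd z - m)" for z :: "'a \<times> 'a"
      by simp
    have "wasserstein2_sq F\<^sub>0 (rescale m c u F)
      \<le> (\<integral>\<^sup>+z. ennreal (1/2 * (norm (fst z - snd z))\<^sup>2) \<partial>distr \<gamma> (borel \<Otimes>\<^sub>M borel) ?T)"
      by (rule wasserstein2_sq_le[OF rescale_coupling[OF \<gamma> P\<^sub>0 F c0]])
    also have "\<dots> = (\<integral>\<^sup>+z. ennreal (1/2 * (norm (1 *\<^sub>R (fst z - u) - c *\<^sub>R (snd z - m)))\<^sup>2) \<partial>\<gamma>)"
      by (subst nn_integral_distr[OF T]) (simp_all only: eq fst_conv snd_conv, measurable)
    also have "\<dots> = ennreal (DIM('a) * \<theta> - c * correlation u u \<gamma>)"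
      unfolding transport_cost_eq(1)[OF \<gamma> P\<^sub>0 F] sm\<^sub>0 correlation_recenter[OF \<gamma> P\<^sub>0 F m\<^sub>0, of m u]
      using c(2) by (simp add: field_simps)
    also have "\<dots> \<le> ennreal (DIM('a) * \<theta> - correlation u u \<gamma>)"
      using True c(1) mult_right_mono[of 1 c "correlation u u \<gamma>"] by (intro ennreal_leI) simp
    finally show ?thesis .
  next
    case False
    note pc = product_coupling[OF P\<^sub>0 R(1)]
    have eq: "fst z - snd z = 1 *\<^sub>R (fst z - u) - 1 *\<^sub>R (snd z - u)" for z :: "'a \<times> 'a" by simp
    have "wasserstein2_sq F\<^sub>0 (rescale m c u F) \<le> ennreal (DIM('a) * \<theta>)"
      using wasserstein2_sq_le[OF pc] unfolding eq transport_cost_eq(1)[OF pc P\<^sub>0 R(1)] correlation_product[OF P\<^sub>0 R(1,3)] sm\<^sub>0 R(2) by (simp add: mult.commute)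
    also have "\<dots> \<le> ennreal (DIM('a) * \<theta> - correlation u u \<gamma>)"
      using False by (intro ennreal_leI) simp
    finally show ?thesis .
  qed
qed

subsection \<open>Existence and uniqueness\<close>

lemma nn_integral_AE_limit_le:
  fixes f :: "nat \<Rightarrow> 'a \<Rightarrow> real"
  assumes [measurable]: "\<And>n. f n \<in> borel_measurable M"
    and lim: "AE x in M. (\<lambda>n. f n x) \<longlonglongrightarrow> g x"
    and bound: "\<And>n. n \<ge> N \<Longrightarrow> (\<integral>\<^sup>+x. ennreal (f n x) \<partial>M) \<le> B"
  shows "(\<integral>\<^sup>+x. ennreal (g x) \<partial>M) \<le> B"
proof -
  have "(\<integral>\<^sup>+x. ennreal (g x) \<partial>M) = (\<integral>\<^sup>+x. liminf (\<lambda>n. ennreal (f n x)) \<partial>M)"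
    using lim by (intro nn_integral_cong_AE) (auto intro!: lim_imp_Liminf[symmetric] tendsto_ennrealI)
  also have "\<dots> \<le> liminf (\<lambda>n. \<integral>\<^sup>+x. ennreal (f n x) \<partial>M)"
    by (rule nn_integral_liminf) simp
  also have "\<dots> \<le> liminf (\<lambda>n. B)"
    by (rule Liminf_mono) (use bound in \<open>auto simp: eventually_sequentially\<close>)
  finally show ?thesis by (simp add: Liminf_const)
qed

text \<open>A subsequence converges almost everywhere, which the nonlinear entropy requires, and
  Fatou's lemma turns the Cauchy estimate into L1 convergence along it. Second moments are not
  mentioned, since they may drop in the limit.\<close>

lemma L1_Cauchy_densities_limit:
  fixes s :: "nat \<Rightarrow> 'a::euclidean_space \<Rightarrow> real"
  assumes P: "\<And>n. s n \<in> prob_densities"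
    and Cauchy: "\<forall>e>0. \<exists>N. \<forall>i\<ge>N. \<forall>j\<ge>N. (\<integral>\<^sup>+v. ennreal \<bar>s i v - s j v\<bar> \<partial>lborel) \<le> ennreal e"
  obtains r F where "strict_mono r" "F \<in> borel_measurable borel" "\<forall>v. 0 \<le> F v"
    "AE v in lborel. (\<lambda>i. s (r i) v) \<longlonglongrightarrow> F v"
    "(\<integral>\<^sup>+v. ennreal (F v) \<partial>lborel) = 1"
    "\<forall>e>0. \<exists>N. \<forall>n\<ge>N. (\<integral>\<^sup>+v. ennreal \<bar>F v - s (r n) v\<bar> \<partial>lborel) \<le> ennreal e"
proof -
  have meas [measurable]: "s n \<in> borel_measurable borel" for n using P by (rule prob_densities_measurable)
  have "\<exists>N. \<forall>i\<ge>N. \<forall>j\<ge>N. (LINT v|lborel. norm (s i v - s j v)) < e" if "e > 0" for e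
  proof -
    obtain N where N: "\<And>i j. i \<ge> N \<Longrightarrow> j \<ge> N \<Longrightarrow> (\<integral>\<^sup>+v. ennreal \<bar>s i v - s j v\<bar> \<partial>lborel) \<le> ennreal (e/2)"
      using Cauchy[rule_format, of "e/2"] \<open>e > 0\<close> by auto
    have "(LINT v|lborel. norm (s i v - s j v)) < e" if "i \<ge> N" "j \<ge> N" for i j
    proof -
      have "ennreal (LINT v|lborel. norm (s i v - s j v)) = (\<integral>\<^sup>+v. ennreal \<bar>s i v - s j v\<bar> \<partial>lborel)"
        using prob_densities_integrable(1)[OF P]
        by (subst nn_integral_eq_integral[symmetric]) auto
      then have "ennreal (LINT v|lborel. norm (s i v - s j v)) \<le> ennreal (e/2)" using N[OF that] by simp
      then have "(LINT v|lborel. norm (s i v - s j v)) \<le> e/2" using \<open>e > 0\<close> by (subst (asm) ennreal_le_iff) auto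
      then show ?thesis using \<open>e > 0\<close> by simp
    qed
    then show ?thesis by blast
  qed
  then obtain r where r: "strict_mono r" "AE v in lborel. Cauchy (\<lambda>i. s (r i) v)"
    using cauchy_L1_AE_cauchy_subseq[of lborel s] prob_densities_integrable(1)[OF P] by blast
  \<comment> \<open>Off the set of convergence \<open>lim\<close> is unspecified;
    \<open>max 0\<close> makes \<open>F\<close> nonnegative everywhere and changes nothing where the
    sequence converges.\<close>
  define F where "F v = max 0 (lim (\<lambda>i. s (r i) v))" for v
  have [measurable]: "F \<in> borel_measurable borel" unfolding F_def by measurable
  have lim: "AE v in lborel. (\<lambda>i. s (r i) v) \<longlonglongrightarrow> F v"
    using r(2)
  proof eventually_elim
    case (elim v)
    then have *: "(\<lambda>i. s (r i) v) \<longlonglongrightarrow> lim (\<lambda>i. s (r i) v)"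
      using Cauchy_convergent convergent_LIMSEQ_iff by blast
    moreover have "0 \<le> lim (\<lambda>i. s (r i) v)"
      by (rule LIMSEQ_le_const[OF *]) (simp add: prob_densities_nonneg[OF P])
    ultimately show ?case by (simp add: F_def)
  qed
  have L1: "\<exists>N. \<forall>n\<ge>N. (\<integral>\<^sup>+v. ennreal \<bar>F v - s (r n) v\<bar> \<partial>lborel) \<le> ennreal e" if "e > 0" for e
  proof -
    obtain N where N: "\<And>i j. i \<ge> N \<Longrightarrow> j \<ge> N \<Longrightarrow> (\<integral>\<^sup>+v. ennreal \<bar>s i v - s j v\<bar> \<partial>lborel) \<le> ennreal e"
      using Cauchy[rule_format, OF \<open>e > 0\<close>] by auto
    have "(\<integral>\<^sup>+v. ennreal \<bar>F v - s (r n) v\<bar> \<partial>lborel) \<le> ennreal e" if "n \<ge> N" for n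
    proof (rule nn_integral_AE_limit_le[where f="\<lambda>k v. \<bar>s (r k) v - s (r n) v\<bar>" and N=N])
      show "AE v in lborel. (\<lambda>k. \<bar>s (r k) v - s (r n) v\<bar>) \<longlonglongrightarrow> \<bar>F v - s (r n) v\<bar>"
        using lim by eventually_elim (intro tendsto_intros)
      show "(\<integral>\<^sup>+v. ennreal \<bar>s (r k) v - s (r n) v\<bar> \<partial>lborel) \<le> ennreal e" if "k \<ge> N" for k
        using N \<open>n \<ge> N\<close> that seq_suble[OF r(1)] order_trans by blast
    qed simp
    then show ?thesis by blast
  qed
  have "(\<integral>\<^sup>+v. ennreal (F v) \<partial>lborel) = 1"
  proof (rule antisym)
    show "(\<integral>\<^sup>+v. ennreal (F v) \<partial>lborel) \<le> 1"
    proof (rule nn_integral_AE_limit_le[where f="\<lambda>n v. s (r n) v" and N=0])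
      show "AE v in lborel. (\<lambda>n. s (r n) v) \<longlonglongrightarrow> F v" by (rule lim)
    qed (simp_all add: prob_densities_nn_integral[OF P])
    \<comment> \<open>Fatou's lemma alone would permit a loss of mass; L1 convergence excludes
      it.\<close>
    show "1 \<le> (\<integral>\<^sup>+v. ennreal (F v) \<partial>lborel)"
    proof (rule ennreal_le_epsilon)
      fix e :: real assume "e > 0"
      then obtain n where n: "(\<integral>\<^sup>+v. ennreal \<bar>F v - s (r n) v\<bar> \<partial>lborel) \<le> ennreal e" using L1 by blast
      have "1 = (\<integral>\<^sup>+v. ennreal (s (r n) v) \<partial>lborel)" by (simp add: prob_densities_nn_integral[OF P])
      also have "\<dots> \<le> (\<integral>\<^sup>+v. ennreal (F v) + ennreal \<bar>F v - s (r n) v\<bar> \<partial>lborel)"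
      proof (intro nn_integral_mono)
        fix v
        have "s (r n) v \<le> F v + \<bar>F v - s (r n) v\<bar>" by simp
        then have "ennreal (s (r n) v) \<le> ennreal (F v + \<bar>F v - s (r n) v\<bar>)" by (rule ennreal_leI)
        then show "ennreal (s (r n) v) \<le> ennreal (F v) + ennreal \<bar>F v - s (r n) v\<bar>"
          by (simp add: ennreal_plus F_def)
      qed
      also have "\<dots> \<le> (\<integral>\<^sup>+v. ennreal (F v) \<partial>lborel) + ennreal e"
        using n by (simp add: nn_integral_add)
      finally show "1 \<le> (\<integral>\<^sup>+v. ennreal (F v) \<partial>lborel) + ennreal e" .
    qed
  qed
  then show thesis using that[OF r(1) _ _ lim] L1 by (simp add: F_def)
qed

text \<open>Away from 0 this is continuity of \<open>ln\<close>. At 0 the product is squeezed by an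
  explicit majorant: \<open>ln (1 / sqrt y) \<le> 1 / sqrt y - 1\<close> controls it from below and
  \<open>ln y \<le> y - 1\<close> from above.\<close>

lemma tendsto_xlnx:
  fixes x :: real
  assumes x: "0 \<le> x" and f: "(f \<longlongrightarrow> x) A" "\<And>n. 0 \<le> f n"
  shows "((\<lambda>n. f n * ln (f n)) \<longlongrightarrow> x * ln x) A"
proof -
  show ?thesis
  proof (cases "x = 0")
    case False
    then show ?thesis using f by (auto intro!: tendsto_intros)
  next
    case True
    have bound: "\<bar>y * ln y\<bar> \<le> y + 2 * sqrt y + y\<^sup>2" if "0 \<le> y" for y :: real
    proof (cases "y = 0")
      case False
      then have y: "y > 0" using that by simp
      have "ln (1 / sqrt y) \<le> 1 / sqrt y - 1" using y by (intro ln_le_minus_one) auto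
      then have "- ln y \<le> 2 / sqrt y" using y by (simp add: ln_div ln_sqrt)
      then have "y * - ln y \<le> y * (2 / sqrt y)" using y by (intro mult_left_mono) auto
      also have "y * (2 / sqrt y) = 2 * (y / sqrt y)" by simp
      also have "y / sqrt y = sqrt y" using y by (intro real_div_sqrt) simp
      finally have 1: "- (y * ln y) \<le> 2 * sqrt y" by simp
      have 2: "y * ln y \<le> y * y" using ln_le_minus_one[OF y] y by (intro mult_left_mono) auto
      have "0 \<le> sqrt y" "0 \<le> y * y" using y by simp_all
      then show ?thesis using 1 2 y unfolding power2_eq_square by linarith
    qed simp
    have "((\<lambda>n. f n + 2 * sqrt (f n) + (f n)\<^sup>2) \<longlongrightarrow> 0 + 2 * sqrt 0 + 0\<^sup>2) A"
      using f(1) True by (intro tendsto_intros) auto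
    then have "((\<lambda>n. f n + 2 * sqrt (f n) + (f n)\<^sup>2) \<longlongrightarrow> 0) A" by simp
    then have "((\<lambda>n. f n * ln (f n)) \<longlongrightarrow> 0) A"
    proof (rule Lim_null_comparison[rotated])
      show "eventually (\<lambda>n. norm (f n * ln (f n)) \<le> f n + 2 * sqrt (f n) + (f n)\<^sup>2) A"
        unfolding real_norm_def by (rule always_eventually) (rule allI, rule bound, rule f(2))
    qed
    then show ?thesis using True by simp
  qed
qed

lemma shifted_functional_minimizer:
  fixes u :: "'a::euclidean_space" and \<theta> h :: real and F\<^sub>0 :: "'a \<Rightarrow> real"
  assumes \<theta>: "\<theta> > 0" and h: "h > 0" and F\<^sub>0: "F\<^sub>0 \<in> fixed_moment_densities u \<theta>"
  obtains \<mu> F\<^sub>1 where "0 \<le> \<mu>" "F\<^sub>1 \<in> fixed_moment_densities u \<theta>" "shifted_functional \<theta> h u F\<^sub>0 F\<^sub>1 = ennreal \<mu>"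
    "\<And>F. F \<in> fixed_moment_densities u \<theta> \<Longrightarrow> ennreal \<mu> \<le> shifted_functional \<theta> h u F\<^sub>0 F"
proof -
  let ?E = "fixed_moment_densities u \<theta>" and ?T = "shifted_functional \<theta> h u F\<^sub>0"
  let ?D = "DIM('a) * \<theta>"
  have P\<^sub>0: "F\<^sub>0 \<in> prob_densities" and sm\<^sub>0: "second_moment u F\<^sub>0 = ?D"
    using F\<^sub>0 by (auto simp: fixed_moment_densities_iff)
  have P: "F \<in> prob_densities" and sm: "second_moment u F = ?D" if "F \<in> ?E" for F
    using that by (auto simp: fixed_moment_densities_iff)
  \<comment> \<open>The Hellinger estimate cancels \<open>4 * \<mu>\<close>, which requires the
    infimum to be a real number.\<close>
  have "(INF F\<in>?E. ?T F) < \<infinity>"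
  proof -
    obtain F where F: "F \<in> ?E" "relative_entropy \<theta> u F < \<infinity>"
      using finite_relative_entropy_exists[OF \<theta>] by blast
    then have "?T F < \<infinity>"
      using wasserstein2_sq_finite[OF P\<^sub>0 P[OF F(1)]] by (simp add: shifted_functional_def ennreal_mult_less_top)
    then show ?thesis using F(1) by (meson INF_lower order_le_less_trans)
  qed
  then obtain \<mu> where \<mu>: "(INF F\<in>?E. ?T F) = ennreal \<mu>" "\<mu> \<ge> 0"
    by (cases "INF F\<in>?E. ?T F") auto
  have low: "ennreal \<mu> \<le> ?T F" if "F \<in> ?E" for F
    unfolding \<mu>(1)[symmetric] using that by (rule INF_lower)
  have "\<exists>F. F \<in> ?E \<and> ?T F \<le> ennreal (\<mu> + 1 / real (Suc n))" for n
  proof -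
    have "(INF F\<in>?E. ?T F) < ennreal (\<mu> + 1 / real (Suc n))"
      unfolding \<mu>(1) using \<mu>(2) by (intro ennreal_lessI) (auto intro: add_nonneg_pos)
    then show ?thesis unfolding INF_less_iff by (auto intro: less_imp_le)
  qed
  then obtain s where s: "\<And>n. s n \<in> ?E" "\<And>n. ?T (s n) \<le> ennreal (\<mu> + 1 / real (Suc n))"
    by metis
  have Ps: "s n \<in> prob_densities" for n using P s by blast
  note [measurable] = prob_densities_measurable[OF Ps]
  have near: "?T (s n) \<le> ennreal (\<mu> + e)" if "inverse (real (Suc N)) < e" "n \<ge> N" for n N e
  proof -
    have "1 / real (Suc n) \<le> inverse (real (Suc N))" using \<open>n \<ge> N\<close> by (simp add: field_simps)
    then show ?thesis using that(1) by (intro order_trans[OF s(2)] ennreal_leI) simp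
  qed
  have "\<exists>N. \<forall>i\<ge>N. \<forall>j\<ge>N. (\<integral>\<^sup>+v. ennreal \<bar>s i v - s j v\<bar> \<partial>lborel) \<le> ennreal e" if e: "e > 0" for e
  proof -
    \<comment> \<open>With weight \<open>K = 4 / e\<close>, the Hellinger bound
      \<open>4 * \<delta> / h = e\<^sup>2 / 4\<close> contributes \<open>e / 2\<close>, and the
      remainder \<open>2 / K\<close> contributes the other \<open>e / 2\<close>.\<close>
    define \<delta> where "\<delta> = h * e\<^sup>2 / 16"
    have "\<delta> > 0" using h e by (simp add: \<delta>_def)
    then obtain N where N: "inverse (real (Suc N)) < \<delta>" using reals_Archimedean by blast
    have "(\<integral>\<^sup>+v. ennreal \<bar>s i v - s j v\<bar> \<partial>lborel) \<le> ennreal e" if "i \<ge> N" "j \<ge> N" for i j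
    proof -
      have H: "hellinger_sq (s i) (s j) \<le> ennreal (4 * \<delta> / h)"
        using near[OF N] that \<mu>(2) \<open>\<delta> > 0\<close>
        by (intro hellinger_sq_near_minimizers[OF h P\<^sub>0 s(1) s(1) low]) auto
      have "(\<integral>\<^sup>+v. ennreal \<bar>s i v - s j v\<bar> \<partial>lborel) \<le> ennreal (4/e/2) * hellinger_sq (s i) (s j) + ennreal (2/(4/e))"
        using e by (intro L1_le_hellinger_sq Ps) auto
      also have "\<dots> \<le> ennreal (4/e/2) * ennreal (4 * \<delta> / h) + ennreal (2/(4/e))"
        by (intro add_right_mono mult_left_mono H) simp
      also have "\<dots> = ennreal (4/e/2 * (4 * \<delta> / h) + 2/(4/e))"
        using e h \<open>\<delta> > 0\<close> by (simp add: ennreal_mult[symmetric] ennreal_plus[symmetric] del: ennreal_plus)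
      also have "4/e/2 * (4 * \<delta> / h) + 2/(4/e) = e"
        using e h by (simp add: \<delta>_def field_simps power2_eq_square)
      finally show ?thesis .
    qed
    then show ?thesis by blast
  qed
  then have Cauchy: "\<forall>e>0. \<exists>N. \<forall>i\<ge>N. \<forall>j\<ge>N. (\<integral>\<^sup>+v. ennreal \<bar>s i v - s j v\<bar> \<partial>lborel) \<le> ennreal e"
    by blast
  obtain r F where r: "strict_mono r" and [measurable]: "F \<in> borel_measurable borel" and nn': "\<forall>v. 0 \<le> F v"
    and lim: "AE v in lborel. (\<lambda>i. s (r i) v) \<longlonglongrightarrow> F v"
    and one: "(\<integral>\<^sup>+v. ennreal (F v) \<partial>lborel) = 1"
    and L1: "\<forall>e>0. \<exists>N. \<forall>n\<ge>N. (\<integral>\<^sup>+v. ennreal \<bar>F v - s (r n) v\<bar> \<partial>lborel) \<le> ennreal e"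
    by (rule L1_Cauchy_densities_limit[OF Ps Cauchy])
  have nn: "0 \<le> F v" for v using nn' by simp
  have smF: "(\<integral>\<^sup>+v. ennreal ((norm (v - u))\<^sup>2 * F v) \<partial>lborel) \<le> ennreal ?D"
  proof (rule nn_integral_AE_limit_le[where f="\<lambda>n v. (norm (v - u))\<^sup>2 * s (r n) v" and N=0])
    show "AE v in lborel. (\<lambda>n. (norm (v - u))\<^sup>2 * s (r n) v) \<longlonglongrightarrow> (norm (v - u))\<^sup>2 * F v"
      using lim by eventually_elim (intro tendsto_intros)
  qed (simp_all add: nn_integral_second_moment[OF Ps] sm[OF s(1)])
  have PF: "F \<in> prob_densities"
    using smF by (intro prob_densitiesI[where c=u] nn one) (auto intro: order_le_less_trans)
  have smF': "second_moment u F \<le> ?D"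
    using smF \<theta> unfolding nn_integral_second_moment[OF PF] by (simp add: ennreal_le_iff)
  define m where "m = (\<integral>v. F v *\<^sub>R v \<partial>lborel)"
  note m = m_def[symmetric]
  note pos = second_moment_pos[OF PF, of m]
  define c where "c = sqrt (?D / second_moment m F)"
  have c: "c \<ge> 1" "c\<^sup>2 * second_moment m F = ?D"
    using pos \<theta> second_moment_mean_le[OF PF m, of u] smF' by (simp_all add: c_def)
  define F\<^sub>1 where "F\<^sub>1 = rescale m c u F"
  have F\<^sub>1: "F\<^sub>1 \<in> ?E"
    unfolding F\<^sub>1_def using c by (intro rescale_in_fixed_moment_densities PF m) auto
  \<comment> \<open>Lower semicontinuity in the form of an eventual upper bound: this is how the
    entropy of the sequence is controlled below, beyond an index that depends on the
    tolerance.\<close>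
  have H\<^sub>1: "relative_entropy \<theta> u F\<^sub>1 \<le> B" if "\<And>n. n \<ge> N \<Longrightarrow> relative_entropy \<theta> u (s (r n)) \<le> B" for B N
  proof -
    have "relative_entropy \<theta> u F\<^sub>1 \<le> relative_entropy \<theta> u F"
      unfolding F\<^sub>1_def by (rule relative_entropy_rescale_le[OF \<theta> PF m c])
    also have "\<dots> \<le> B"
      unfolding relative_entropy_def
    proof (rule nn_integral_AE_limit_le)
      show "AE v in lborel. (\<lambda>n. relative_entropy_density \<theta> u (s (r n) v) v) \<longlonglongrightarrow> relative_entropy_density \<theta> u (F v) v"
        using lim
      proof eventually_elim
        case (elim v)
        have "(\<lambda>n. s (r n) v * ln (s (r n) v)) \<longlonglongrightarrow> F v * ln (F v)"
          using nn elim by (rule tendsto_xlnx) (rule prob_densities_nonneg[OF Ps])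
        then show ?case
          unfolding relative_entropy_density_def
          by (rule tendsto_add[OF tendsto_diff[OF tendsto_add[OF _ tendsto_mult[OF tendsto_const elim]] elim] tendsto_const])
      qed
      show "(\<integral>\<^sup>+v. ennreal (relative_entropy_density \<theta> u (s (r n) v) v) \<partial>lborel) \<le> B" if "n \<ge> N" for n
        using \<open>\<And>n. n \<ge> N \<Longrightarrow> relative_entropy \<theta> u (s (r n)) \<le> B\<close>[OF that] by (simp add: relative_entropy_def)
    qed simp
    finally show ?thesis .
  qed
  \<comment> \<open>One half of \<open>\<eta>\<close> pays for a near-optimal coupling of
    \<open>F\<^sub>0\<close> with the sequence, the other for the correlation lost in passing to the
    limit.\<close>
  have W\<^sub>1: "\<exists>N. \<forall>n\<ge>N. wasserstein2_sq F\<^sub>0 F\<^sub>1 \<le> wasserstein2_sq F\<^sub>0 (s (r n)) + ennreal \<eta>" if "\<eta> > 0" for \<eta>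
  proof -
    have "0 \<le> ?D" "0 < \<eta>/2" using \<theta> \<open>\<eta> > 0\<close> by auto
    obtain \<delta> where "\<delta> > 0" and \<delta>: "\<forall>F\<in>prob_densities. \<forall>G\<in>prob_densities. second_moment u F \<le> ?D \<longrightarrow> second_moment u G \<le> ?D \<longrightarrow>
       (\<forall>\<gamma>\<in>couplings F\<^sub>0 G. (\<integral>\<^sup>+w. ennreal (max 0 (F w - G w)) \<partial>lborel) \<le> ennreal \<delta> \<longrightarrow>
         (\<exists>\<gamma>'\<in>couplings F\<^sub>0 F. correlation u u \<gamma> \<le> correlation u u \<gamma>' + \<eta>/2))"
      by (rule correlation_perturbation[OF P\<^sub>0 \<open>0 \<le> ?D\<close> \<open>0 < \<eta>/2\<close>, of u])
    obtain N where N: "\<And>n. n \<ge> N \<Longrightarrow> (\<integral>\<^sup>+v. ennreal \<bar>F v - s (r n) v\<bar> \<partial>lborel) \<le> ennreal \<delta>"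
      using L1[rule_format, OF \<open>\<delta> > 0\<close>] by blast
    have "wasserstein2_sq F\<^sub>0 F\<^sub>1 \<le> wasserstein2_sq F\<^sub>0 (s (r n)) + ennreal \<eta>" if "n \<ge> N" for n
    proof -
      let ?G = "s (r n)"
      obtain \<gamma> where \<gamma>: "\<gamma> \<in> couplings F\<^sub>0 ?G"
        "(\<integral>\<^sup>+z. ennreal (1/2 * (norm (fst z - snd z))\<^sup>2) \<partial>\<gamma>) \<le> wasserstein2_sq F\<^sub>0 ?G + ennreal (\<eta>/2)"
        using wasserstein2_sq_approx[OF P\<^sub>0 Ps \<open>0 < \<eta>/2\<close>] .
      have "(\<integral>\<^sup>+w. ennreal (max 0 (F w - ?G w)) \<partial>lborel) \<le> (\<integral>\<^sup>+v. ennreal \<bar>F v - ?G v\<bar> \<partial>lborel)"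
        by (intro nn_integral_mono ennreal_leI) auto
      also note N[OF that]
      finally obtain \<gamma>' where \<gamma>': "\<gamma>' \<in> couplings F\<^sub>0 F" "correlation u u \<gamma> \<le> correlation u u \<gamma>' + \<eta>/2"
        using \<delta>[rule_format, OF PF Ps smF' _ \<gamma>(1)] sm[OF s(1)] by auto
      have eq: "fst z - snd z = 1 *\<^sub>R (fst z - u) - 1 *\<^sub>R (snd z - u)" for z :: "'a \<times> 'a" by simp
      have cost: "(\<integral>\<^sup>+z. ennreal (1/2 * (norm (fst z - snd z))\<^sup>2) \<partial>\<gamma>) = ennreal (?D - correlation u u \<gamma>)"
        and cost0: "0 \<le> ?D - correlation u u \<gamma>"
        unfolding eq transport_cost_eq(1)[OF \<gamma>(1) P\<^sub>0 Ps] using transport_cost_eq(2)[OF \<gamma>(1) P\<^sub>0 Ps, of 1 u 1 u]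
        by (simp_all add: sm\<^sub>0 sm[OF s(1)] mult.commute)
      have "wasserstein2_sq F\<^sub>0 F\<^sub>1 \<le> ennreal (?D - correlation u u \<gamma>')"
        unfolding F\<^sub>1_def by (rule wasserstein2_sq_rescale_le[OF F\<^sub>0 PF m c \<gamma>'(1)])
      also have "\<dots> \<le> ennreal (?D - correlation u u \<gamma> + \<eta>/2)"
        using \<gamma>'(2) by (intro ennreal_leI) simp
      also have "\<dots> = ennreal (?D - correlation u u \<gamma>) + ennreal (\<eta>/2)"
        using cost0 \<open>\<eta> > 0\<close> by (simp add: ennreal_plus)
      also have "\<dots> \<le> wasserstein2_sq F\<^sub>0 ?G + ennreal (\<eta>/2) + ennreal (\<eta>/2)"
        using \<gamma>(2) unfolding cost by (rule add_right_mono)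
      also have "\<dots> = wasserstein2_sq F\<^sub>0 ?G + ennreal \<eta>"
        using \<open>\<eta> > 0\<close> by (simp add: add.assoc ennreal_plus[symmetric] del: ennreal_plus)
      finally show ?thesis .
    qed
    then show ?thesis by blast
  qed
  have "?T F\<^sub>1 \<le> ennreal \<mu>"
  proof (rule ennreal_le_epsilon)
    fix e :: real assume e: "e > 0"
    \<comment> \<open>The transport term is divided by \<open>\<theta>\<close>, so this tolerance
      costs \<open>e / 2\<close> in the functional; the other half is spent on near-minimality of
      the sequence.\<close>
    have "\<theta> * (e/2) > 0" using \<theta> e by simp
    from W\<^sub>1[OF this] obtain N1 where N1: "\<And>n. n \<ge> N1 \<Longrightarrow> wasserstein2_sq F\<^sub>0 F\<^sub>1 \<le> wasserstein2_sq F\<^sub>0 (s (r n)) + ennreal (\<theta> * (e/2))"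
      by blast
    obtain N2 where N2: "inverse (real (Suc N2)) < e/2" using reals_Archimedean[of "e/2"] e by auto
    obtain w where w: "wasserstein2_sq F\<^sub>0 F\<^sub>1 = ennreal w" "0 \<le> w"
      using wasserstein2_sq_finite[OF P\<^sub>0 P[OF F\<^sub>1]] by (cases "wasserstein2_sq F\<^sub>0 F\<^sub>1") auto
    \<comment> \<open>The relative entropy at which \<open>F\<^sub>1\<close> would have value
      exactly \<open>\<mu> + e\<close>. Solving for the entropy with the fixed \<open>w\<close> in
      place of the varying transport costs separates the two semicontinuity statements. That
      \<open>0 \<le> b\<close> is recorded below because \<open>ennreal b\<close> would otherwise
      truncate.\<close>
    define b where "b = (\<mu> + e - w / \<theta>) / h"
    have bound: "relative_entropy \<theta> u (s (r n)) \<le> ennreal b \<and> 0 \<le> b" if "n \<ge> max N1 N2" for n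
    proof -
      obtain w' where w': "wasserstein2_sq F\<^sub>0 (s (r n)) = ennreal w'" "0 \<le> w'"
        using wasserstein2_sq_finite[OF P\<^sub>0 Ps[of "r n"]] by (cases "wasserstein2_sq F\<^sub>0 (s (r n))") auto
      have "w \<le> w' + \<theta> * (e/2)"
        using N1[of n] that w w' e \<theta> by (simp add: ennreal_plus[symmetric] ennreal_le_iff del: ennreal_plus)
      then have ww: "w / \<theta> \<le> w' / \<theta> + e/2" using \<theta> by (simp add: field_simps)
      have "r n \<ge> N2" using that seq_suble[OF r, of n] by simp
      from near[OF N2 this] have T: "ennreal (1/\<theta>) * ennreal w' + ennreal h * relative_entropy \<theta> u (s (r n)) \<le> ennreal (\<mu> + e/2)"
        unfolding shifted_functional_def w' .
      then obtain x where x: "relative_entropy \<theta> u (s (r n)) = ennreal x" "0 \<le> x"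
        using h by (cases "relative_entropy \<theta> u (s (r n))") (auto simp: ennreal_mult_top top_unique)
      have "w' / \<theta> + h * x \<le> \<mu> + e/2"
        using T w' x h \<theta> \<mu>(2) e by (simp add: ennreal_mult[symmetric] ennreal_plus[symmetric] ennreal_le_iff del: ennreal_plus)
      then have "h * x \<le> \<mu> + e - w / \<theta>" using ww by linarith
      then have "x \<le> b" using h by (simp add: b_def pos_le_divide_eq mult.commute)
      then show ?thesis using x by (auto intro: ennreal_leI)
    qed
    have H: "relative_entropy \<theta> u F\<^sub>1 \<le> ennreal b" using bound by (intro H\<^sub>1[of "max N1 N2"]) blast
    have "?T F\<^sub>1 \<le> ennreal (1/\<theta>) * ennreal w + ennreal h * ennreal b"
      unfolding shifted_functional_def w by (intro add_left_mono mult_left_mono H) simp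
    also have "\<dots> = ennreal (w / \<theta> + h * b)"
      using w \<theta> h bound[of "max N1 N2"] by (simp add: ennreal_mult[symmetric] ennreal_plus[symmetric] del: ennreal_plus)
    also have "w / \<theta> + h * b = \<mu> + e" using h by (simp add: b_def)
    also have "ennreal (\<mu> + e) = ennreal \<mu> + ennreal e" using \<mu>(2) e by (simp add: ennreal_plus)
    finally show "?T F\<^sub>1 \<le> ennreal \<mu> + ennreal e" .
  qed
  then have "?T F\<^sub>1 = ennreal \<mu>" using low[OF F\<^sub>1] by (rule antisym)
  then show thesis using that[OF \<mu>(2) F\<^sub>1 _ low] by blast
qed

theorem theorem5p2:
  fixes u :: "'a::euclidean_space" and \<theta> h :: real and F\<^sub>0 :: "'a \<Rightarrow> real"
  assumes "\<theta> > 0" and "h > 0"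
    and "F\<^sub>0 \<in> fixed_moment_densities u \<theta>"
  shows "\<exists>F\<^sub>1 \<in> fixed_moment_densities u \<theta>.
           (\<forall>F \<in> fixed_moment_densities u \<theta>.
              step_functional \<theta> h F\<^sub>0 F\<^sub>1 \<le> step_functional \<theta> h F\<^sub>0 F) \<and>
           (\<forall>G \<in> fixed_moment_densities u \<theta>.
              (\<forall>F \<in> fixed_moment_densities u \<theta>.
                 step_functional \<theta> h F\<^sub>0 G \<le> step_functional \<theta> h F\<^sub>0 F) \<longrightarrow>
              (AE v in lborel. G v = F\<^sub>1 v))"
proof -
  let ?E = "fixed_moment_densities u \<theta>" and ?T = "shifted_functional \<theta> h u F\<^sub>0"
  have P\<^sub>0: "F\<^sub>0 \<in> prob_densities" using assms(3) by (simp add: fixed_moment_densities_iff)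
  \<comment> \<open>The two functionals differ by a finite constant, which cancels from the
    inequality even where a value is infinite.\<close>
  have le_iff: "step_functional \<theta> h F\<^sub>0 F \<le> step_functional \<theta> h F\<^sub>0 G \<longleftrightarrow> ?T F \<le> ?T G"
    if "F \<in> ?E" "G \<in> ?E" for F G
    using that by (simp add: step_functional_eq[OF assms(1,2) P\<^sub>0] less_eq_ennreal.rep_eq ereal_add_le_add_iff2)
  obtain \<mu> F\<^sub>1 where "0 \<le> \<mu>" and F\<^sub>1: "F\<^sub>1 \<in> ?E" "?T F\<^sub>1 = ennreal \<mu>"
    and low: "\<And>F. F \<in> ?E \<Longrightarrow> ennreal \<mu> \<le> ?T F"
    using shifted_functional_minimizer[OF assms] by blast
  show ?thesis
  proof (intro bexI[OF _ F\<^sub>1(1)] conjI ballI impI)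
    fix F assume "F \<in> ?E"
    then show "step_functional \<theta> h F\<^sub>0 F\<^sub>1 \<le> step_functional \<theta> h F\<^sub>0 F"
      using low F\<^sub>1 by (simp add: le_iff)
  next
    fix G assume G: "G \<in> ?E" "\<forall>F\<in>?E. step_functional \<theta> h F\<^sub>0 G \<le> step_functional \<theta> h F\<^sub>0 F"
    then have "?T G \<le> ennreal \<mu>" using F\<^sub>1 le_iff by metis
    \<comment> \<open>Both densities attain the minimum, so the near-minimizer estimate applies with
      error \<open>e = 0\<close>.\<close>
    then have "hellinger_sq G F\<^sub>1 \<le> ennreal (4 * 0 / h)"
      using F\<^sub>1 \<open>0 \<le> \<mu>\<close> by (intro hellinger_sq_near_minimizers[OF assms(2) P\<^sub>0 G(1) F\<^sub>1(1) low]) auto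
    then show "AE v in lborel. G v = F\<^sub>1 v"
      using G(1) F\<^sub>1(1) by (intro hellinger_sq_eq_0) (auto simp: fixed_moment_densities_iff)
  qed
qed

end
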